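(* Let $N\geq 0$ be an integer and let $f(x)=\sum_{n\geq N}a_nx^n$ be an entire function on $\mathbb{C}_p$ such that $a_n\neq0$ for every $n\geq N$. Suppose that there exists an integer $n_0\geq N$ such that $(|a_n/a_{n+1}|)_{n\geq n_0}$ is a strictly increasing unbounded sequence. Then the function $f$ is pseudo-prime.
   Context: $p$ is a prime number and $\mathbb{C}_p$ is the completion of an algebraic closure of the field $\mathbb{Q}_p$ of $p$-adic numbers, with the usual $p$-adic absolute value $|\cdot|$. $\mathcal{A}(\mathbb{C}_p)$ is the algebra of entire functions on $\mathbb{C}_p$ (power series over $\mathbb{C}_p$ converging on all of $\mathbb{C}_p$), and $\mathcal{M}(\mathbb{C}_p)$, the field of meromorphic functions in $\mathbb{C}_p$, is its field of fractions. A function $F\in\mathcal{M}(\mathbb{C}_p)$ is pseudo-prime if every factorization $F=f\circ g$ with $f,g\in\mathcal{M}(\mathbb{C}_p)$ implies that $f$ or $g$ is a rational function. *)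

theory Defs
  imports
    "HOL-Analysis.Analysis"
    "HOL-Computational_Algebra.Computational_Algebra"
begin

section \<open>The field of $p$-adic complex numbers\<close>

text \<open>
  Fields of characteristic 0 with a non-archimedean absolute value, carrying the induced metric
  and topology. (The constant \<open>norm\<close> is of no use here, since it is reserved for real vector
  spaces.) That \<open>absval\<close> is nonnegative and vanishes only at 0 follows from the metric axioms.
\<close>

class nonarch_field = field_char_0 + metric_space +
  fixes absval :: "'a \<Rightarrow> real"
  assumes dist_absval: "dist x y = absval (x - y)"
    and absval_mult: "absval (x * y) = absval x * absval y"
    and absval_ultrametric: "absval (x + y) \<le> max (absval x) (absval y)"

lemma absval_nonneg: "absval x \<ge> 0"
  for x :: "'a :: nonarch_field"
  using dist_absval[of x 0] zero_le_dist[of x 0] by simp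

lemma absval_eq_0_iff: "absval x = 0 \<longleftrightarrow> x = 0"
  for x :: "'a :: nonarch_field"
  using dist_absval[of x 0] dist_eq_0_iff[of x 0] by simp

text \<open>The $p$-adic absolute value $|q|_p = p^{-v_p(q)}$ on the rationals.\<close>

definition padic_abs :: "nat \<Rightarrow> rat \<Rightarrow> real" where
  "padic_abs p q = (if q = 0 then 0 else
     (let (a, b) = quotient_of q
      in real p powi (int (multiplicity (int p) b) - int (multiplicity (int p) a))))"

definition is_subfield :: "'a :: field set \<Rightarrow> bool" where
  "is_subfield K \<longleftrightarrow> 0 \<in> K \<and> 1 \<in> K \<and>
     (\<forall>x\<in>K. \<forall>y\<in>K. x + y \<in> K \<and> x * y \<in> K) \<and> (\<forall>x\<in>K. - x \<in> K \<and> inverse x \<in> K)"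

definition completion_of :: "'a :: metric_space set \<Rightarrow> 'a set \<Rightarrow> bool" where
  "completion_of C D \<longleftrightarrow> complete C \<and> D \<subseteq> C \<and> C \<subseteq> closure D"

definition poly_over :: "'a :: zero set \<Rightarrow> 'a poly \<Rightarrow> bool" where
  "poly_over K P \<longleftrightarrow> (\<forall>i. coeff P i \<in> K)"

definition algebraic_closure_of :: "'a :: field set \<Rightarrow> 'a set \<Rightarrow> bool" where
  "algebraic_closure_of L K \<longleftrightarrow> K \<subseteq> L \<and>
     (\<forall>x\<in>L. \<exists>P. poly_over K P \<and> P \<noteq> 0 \<and> poly P x = 0) \<and>
     (\<forall>P. poly_over L P \<and> degree P > 0 \<longrightarrow> (\<exists>x\<in>L. poly P x = 0))"

text \<open>
  The type \<open>'a\<close>, with its absolute value, is (a copy of) \<open>\<complex>\<^sub>p\<close>: it is the completion of an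
  algebraic closure \<open>L\<close> of a completion \<open>K\<close> of \<open>\<rat>\<close> under the \<open>p\<close>-adic absolute value. On \<open>L\<close> the
  absolute value is necessarily the unique extension of that of \<open>K\<close>, so these conditions
  determine the valued field up to isometric isomorphism.
\<close>

definition is_padic_complex_field :: "nat \<Rightarrow> 'a :: nonarch_field itself \<Rightarrow> bool" where
  "is_padic_complex_field p _ \<longleftrightarrow>
     (\<forall>q. absval (of_rat q :: 'a) = padic_abs p q) \<and>
     (\<exists>K L :: 'a set. is_subfield K \<and> is_subfield L \<and>
        completion_of K \<rat> \<and> algebraic_closure_of L K \<and> completion_of UNIV L)"


section \<open>Entire and meromorphic functions\<close>

text \<open>
  Entire functions are represented by their power series, and the field of meromorphic functions
  by the field of fractions of the ring of entire functions, formed inside the field of fractions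
  of the ring of all formal power series.
\<close>

definition entire :: "'a :: nonarch_field fps \<Rightarrow> bool" where
  "entire A \<longleftrightarrow> (\<forall>x. summable (\<lambda>n. fps_nth A n * x ^ n))"

definition entire_eval :: "'a :: nonarch_field fps \<Rightarrow> 'a \<Rightarrow> 'a" where
  "entire_eval A x = (\<Sum>n. fps_nth A n * x ^ n)"

definition meromorphic_functions :: "'a :: nonarch_field fps fract set" where
  "meromorphic_functions = {Fract A B |A B. entire A \<and> entire B \<and> B \<noteq> 0}"

definition rational_function :: "'a :: nonarch_field fps fract \<Rightarrow> bool" where
  "rational_function F \<longleftrightarrow>
     (\<exists>P Q. Q \<noteq> 0 \<and> F = Fract (fps_of_poly P) (fps_of_poly Q))"

text \<open>
  \<open>has_value_at F x v\<close>: the meromorphic function \<open>F\<close> has no pole at \<open>x\<close> and takes the value \<open>v\<close>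
  there. The representation of \<open>F\<close> as a quotient may depend on \<open>x\<close>, so removable singularities
  are removed.
\<close>

definition has_value_at :: "'a :: nonarch_field fps fract \<Rightarrow> 'a \<Rightarrow> 'a \<Rightarrow> bool" where
  "has_value_at F x v \<longleftrightarrow>
     (\<exists>A B. entire A \<and> entire B \<and> F = Fract A B \<and> entire_eval B x \<noteq> 0 \<and>
            v = entire_eval A x / entire_eval B x)"

text \<open>
  \<open>F = f \<circ> g\<close> as meromorphic functions: \<open>F x = f (g x)\<close> at every point \<open>x\<close> that is not a pole
  of \<open>g\<close> and for which \<open>g x\<close> is not a pole of \<open>f\<close>. The first conjunct, that such a point exists,
  fails only if \<open>g\<close> is constant and equal to a pole of \<open>f\<close>, when \<open>f \<circ> g\<close> is undefined; in all
  other cases the exceptional points are at most countably many and \<open>F\<close> is uniquely determined.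
\<close>

definition is_composition ::
  "'a :: nonarch_field fps fract \<Rightarrow> 'a fps fract \<Rightarrow> 'a fps fract \<Rightarrow> bool" where
  "is_composition F f g \<longleftrightarrow>
     (\<exists>x y z. has_value_at g x y \<and> has_value_at f y z) \<and>
     (\<forall>x y z. has_value_at g x y \<and> has_value_at f y z \<longrightarrow> has_value_at F x z)"

definition pseudo_prime :: "'a :: nonarch_field fps fract \<Rightarrow> bool" where
  "pseudo_prime F \<longleftrightarrow> F \<in> meromorphic_functions \<and>
     (\<forall>f\<in>meromorphic_functions. \<forall>g\<in>meromorphic_functions.
        is_composition F f g \<longrightarrow> rational_function f \<or> rational_function g)"

end

theory Submission
  imports Defs
begin

text \<open>
  Call \<open>n\<close> a dominant index of an entire function \<open>A = (\<Sum>n. a\<^sub>n x\<^sup>n)\<close> at the radius \<open>r\<close> if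
  \<open>\<bar>a\<^sub>n\<bar> r\<^sup>n\<close> is maximal. Where the dominant index is unique, \<open>\<bar>A x\<bar> = \<bar>a\<^sub>n\<bar> \<bar>x\<bar>\<^sup>n\<close>. The hypothesis
  on \<open>f\<close> says that at every large radius its dominant indices are at most two consecutive numbers.

  Suppose \<open>f = h \<circ> g\<close> with \<open>h\<close> and \<open>g\<close> not rational. If \<open>h\<close> had a pole \<open>b\<close>, then \<open>g\<close> would omit \<open>b\<close>,
  so \<open>1 / (g - b)\<close> would be entire and take all values; hence \<open>b\<close> would be the only pole of \<open>h\<close>, and
  \<open>g\<close> would have a pole. But if \<open>g\<close> has a pole, boundedness of \<open>f\<close> near it makes \<open>h\<close>, whose poles
  are at most \<open>b\<close>, a rational function. So \<open>h\<close> and \<open>g\<close> are entire. Choose a large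
  radius \<open>R\<close> at which \<open>g\<close> has dominant indices \<open>d < d'\<close>, and let \<open>k \<le> k'\<close> be the extreme dominant
  indices of \<open>h\<close> at the radius \<open>\<bar>g\<bar>\<^sub>R\<close>. Just below and just above \<open>R\<close> the dominant index of \<open>f\<close>
  is \<open>k d\<close> and \<open>k' d'\<close>, and these differ by at least \<open>k \<ge> 2\<close>.
\<close>

section \<open>Non-archimedean absolute values\<close>

text \<open>At a radius with several dominant indices, |g x| is not determined by |x|, so f and h o
  g cannot be compared at the critical radius R itself. They are compared on open intervals of radii
  on either side of R: there all three moduli are single monomials, and since the absolute value
  takes a dense set of values, two of them in the interval determine the exponent. The pole analysis
  rests on one fact: an entire function whose index 0 is not strictly dominant at radius r has a
  zero with |x| <= r. C_p is not locally compact, so this zero is built as the limit of a Cauchy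
  sequence of better and better approximate zeros. The fact yields surjectivity of nonconstant
  entire functions and, by cancelling zeros disc by disc, that a meromorphic function without poles
  is entire. The composition is given only pointwise and off the poles, so what happens at a pole is
  read off from nearby values.\<close>

lemma absval_0 [simp]: "absval (0 :: 'a :: nonarch_field) = 0"
  by (simp add: absval_eq_0_iff)

lemma absval_pos_iff [simp]: "absval x > 0 \<longleftrightarrow> x \<noteq> (0 :: 'a :: nonarch_field)"
  using absval_nonneg[of x] absval_eq_0_iff[of x] by auto

lemma absval_1 [simp]: "absval (1 :: 'a :: nonarch_field) = 1"
  using absval_mult[of "1::'a" 1] absval_eq_0_iff[of "1::'a"] by simp

lemma absval_minus [simp]: "absval (- x) = absval (x :: 'a :: nonarch_field)"
proof -
  have "absval (-1 :: 'a) * absval (-1 :: 'a) = 1"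
    by (simp flip: absval_mult)
  then have "absval (-1 :: 'a) = 1"
    using absval_nonneg[of "-1::'a"] by (metis abs_of_nonneg real_sqrt_abs2 real_sqrt_one)
  then show ?thesis
    using absval_mult[of "-1" x] by simp
qed

lemma absval_minus_commute: "absval (x - y) = absval (y - x :: 'a :: nonarch_field)"
  using absval_minus[of "x - y"] by simp

lemma absval_power: "absval (x ^ n) = absval (x :: 'a :: nonarch_field) ^ n"
  by (induction n) (simp_all add: absval_mult)

lemma absval_inverse: "absval (inverse x) = inverse (absval (x :: 'a :: nonarch_field))"
proof (cases "x = 0")
  case False
  then have "absval x * absval (inverse x) = 1"
    by (simp flip: absval_mult)
  then show ?thesis
    by (metis inverse_unique)
qed simp

lemma absval_divide: "absval (x / y) = absval x / absval (y :: 'a :: nonarch_field)"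
  by (simp add: divide_inverse absval_mult absval_inverse)

lemma absval_add_le:
  "absval x \<le> M \<Longrightarrow> absval y \<le> M \<Longrightarrow> absval (x + y :: 'a :: nonarch_field) \<le> M"
  using absval_ultrametric[of x y] by linarith

lemma absval_diff_le:
  "absval x \<le> M \<Longrightarrow> absval y \<le> M \<Longrightarrow> absval (x - y :: 'a :: nonarch_field) \<le> M"
  using absval_add_le[of x M "- y"] by simp

lemma absval_add_less:
  "absval x < M \<Longrightarrow> absval y < M \<Longrightarrow> absval (x + y :: 'a :: nonarch_field) < M"
  using absval_ultrametric[of x y] by linarith

lemma absval_diff_less:
  "absval x < M \<Longrightarrow> absval y < M \<Longrightarrow> absval (x - y :: 'a :: nonarch_field) < M"
  using absval_add_less[of x M "- y"] by simp

text \<open>x = (x + y) + (- y) and |y| < |x| force |x| <= |x + y|; the other inequality is the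
  ultrametric one. This isosceles principle is what lets a single dominant term decide a
  modulus.\<close>

lemma absval_add_eq:
  "absval y < absval x \<Longrightarrow> absval (x + y :: 'a :: nonarch_field) = absval x"
  using absval_ultrametric[of x y] absval_ultrametric[of "x + y" "- y"] by simp

lemma absval_diff_eq:
  "absval y < absval x \<Longrightarrow> absval (x - y :: 'a :: nonarch_field) = absval x"
  using absval_add_eq[of "- y" x] by simp

lemma absval_sum_le:
  fixes f :: "'b \<Rightarrow> 'a :: nonarch_field"
  assumes "\<And>i. i \<in> I \<Longrightarrow> absval (f i) \<le> M" "M \<ge> 0"
  shows "absval (sum f I) \<le> M"
  using assms
  by (induction I rule: infinite_finite_induct) (auto intro!: absval_add_le)

lemma absval_sum_less:
  fixes f :: "'b \<Rightarrow> 'a :: nonarch_field"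
  assumes "\<And>i. i \<in> I \<Longrightarrow> absval (f i) < M" "M > 0"
  shows "absval (sum f I) < M"
  using assms
  by (induction I rule: infinite_finite_induct) (auto intro!: absval_add_less)

lemma absval_triangle: "\<bar>absval x - absval y\<bar> \<le> absval (x - y :: 'a :: nonarch_field)"
proof -
  have "dist x 0 \<le> dist x y + dist y 0" "dist y 0 \<le> dist y x + dist x 0"
    by (rule dist_triangle)+
  then show ?thesis
    by (simp add: dist_absval absval_minus_commute)
qed

section \<open>Limits and the field operations\<close>

lemma tendsto_absval_iff:
  "(f \<longlongrightarrow> l) F \<longleftrightarrow> ((\<lambda>x. absval (f x - l :: 'a :: nonarch_field)) \<longlongrightarrow> 0) F"
  by (subst tendsto_dist_iff) (simp add: dist_absval)

text \<open>With this instance and the next one the general limit and series rules for sums and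
  products apply, although \<open>nonarch_field\<close> only provides a metric tied to
  \<open>absval\<close>.\<close>

instance nonarch_field \<subseteq> topological_ab_group_add
proof
  fix a b :: 'a
  have "((\<lambda>x. absval (fst x - a) + absval (snd x - b)) \<longlongrightarrow> 0) (nhds a \<times>\<^sub>F nhds b)"
    using filterlim_fst[of "nhds a" "nhds b"] filterlim_snd[of "nhds b" "nhds a"]
    by (auto intro!: tendsto_add_zero simp flip: tendsto_absval_iff)
  then show "((\<lambda>x. fst x + snd x) \<longlongrightarrow> a + b) (nhds a \<times>\<^sub>F nhds b)"
    unfolding tendsto_absval_iff[of "\<lambda>x. fst x + snd x"]
  proof (rule Lim_null_comparison[rotated])
    show "\<forall>\<^sub>F x in nhds a \<times>\<^sub>F nhds b.
        norm (absval (fst x + snd x - (a + b))) \<le> absval (fst x - a) + absval (snd x - b)"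
    proof (intro always_eventually allI)
      fix x :: "'a \<times> 'a"
      show "norm (absval (fst x + snd x - (a + b))) \<le> absval (fst x - a) + absval (snd x - b)"
        using absval_ultrametric[of "fst x - a" "snd x - b"] absval_nonneg[of "fst x - a"]
          absval_nonneg[of "snd x - b"] absval_nonneg[of "fst x + snd x - (a + b)"]
        by (simp add: algebra_simps)
    qed
  qed
  have "((\<lambda>x. absval (x - a)) \<longlongrightarrow> 0) (nhds a)"
    by (simp flip: tendsto_absval_iff add: filterlim_ident)
  then show "(uminus \<longlongrightarrow> - a) (nhds a)"
    unfolding tendsto_absval_iff[of uminus]
    by (simp add: absval_minus_commute)
qed

instance nonarch_field \<subseteq> topological_comm_monoid_mult
proof
  fix a b :: 'a
  have *: "(fst \<longlongrightarrow> a) (nhds a \<times>\<^sub>F nhds b)" "(snd \<longlongrightarrow> b) (nhds a \<times>\<^sub>F nhds b)"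
    by (simp_all add: filterlim_fst filterlim_snd)
  then have "((\<lambda>x. absval (fst x - a) * (absval (snd x - b) + absval b)
      + absval a * absval (snd x - b)) \<longlongrightarrow> 0 * (0 + absval b) + absval a * 0)
      (nhds a \<times>\<^sub>F nhds b)"
    by (intro tendsto_intros) (auto simp flip: tendsto_absval_iff)
  then have lim: "((\<lambda>x. absval (fst x - a) * (absval (snd x - b) + absval b)
      + absval a * absval (snd x - b)) \<longlongrightarrow> 0) (nhds a \<times>\<^sub>F nhds b)"
    by simp
  show "((\<lambda>x. fst x * snd x) \<longlongrightarrow> a * b) (nhds a \<times>\<^sub>F nhds b)"
    unfolding tendsto_absval_iff[of "\<lambda>x. fst x * snd x"]
  proof (rule Lim_null_comparison[OF always_eventually lim], intro allI)
    fix x :: "'a \<times> 'a"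
    have "fst x * snd x - a * b = (fst x - a) * snd x + a * (snd x - b)"
      by (simp add: algebra_simps)
    then have "absval (fst x * snd x - a * b)
        \<le> max (absval (fst x - a) * absval (snd x)) (absval a * absval (snd x - b))"
      by (metis absval_ultrametric absval_mult)
    also have "\<dots> \<le> absval (fst x - a) * absval (snd x) + absval a * absval (snd x - b)"
      by (simp add: absval_nonneg)
    also have "\<dots> \<le> absval (fst x - a) * (absval (snd x - b) + absval b)
        + absval a * absval (snd x - b)"
      using absval_triangle[of "snd x" b]
      by (intro add_mono mult_left_mono) (auto simp: absval_nonneg)
    finally show "norm (absval (fst x * snd x - a * b))
        \<le> absval (fst x - a) * (absval (snd x - b) + absval b) + absval a * absval (snd x - b)"
      by (simp add: absval_nonneg)
  qed
qed

lemma tendsto_absval: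
  fixes f :: "'b \<Rightarrow> 'a :: nonarch_field"
  assumes "(f \<longlongrightarrow> l) F"
  shows "((\<lambda>x. absval (f x)) \<longlongrightarrow> absval l) F"
proof -
  have "((\<lambda>x. absval (f x) - absval l) \<longlongrightarrow> 0) F"
  proof (rule Lim_null_comparison[of _ "\<lambda>x. absval (f x - l)"])
    show "((\<lambda>x. absval (f x - l)) \<longlongrightarrow> 0) F"
      using assms tendsto_absval_iff by blast
  qed (simp add: absval_triangle)
  then show ?thesis
    using Lim_null by blast
qed

lemma tendsto_inverse_nonarch:
  fixes f :: "'b \<Rightarrow> 'a :: nonarch_field"
  assumes f: "(f \<longlongrightarrow> l) F" and "l \<noteq> 0"
  shows "((\<lambda>x. inverse (f x)) \<longlongrightarrow> inverse l) F"
proof -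
  have ev: "\<forall>\<^sub>F x in F. absval (f x) > 0"
    using order_tendstoD(1)[OF tendsto_absval[OF f], of 0] \<open>l \<noteq> 0\<close> by simp
  have "((\<lambda>x. absval (f x - l)) \<longlongrightarrow> 0) F"
    using f tendsto_absval_iff by blast
  then have lim: "((\<lambda>x. absval (f x - l) / (absval (f x) * absval l)) \<longlongrightarrow> 0 / (absval l * absval l)) F"
    using \<open>l \<noteq> 0\<close>
    by (intro tendsto_divide tendsto_mult tendsto_const tendsto_absval f) (auto simp: absval_eq_0_iff)
  have "\<forall>\<^sub>F x in F. absval (f x - l) / (absval (f x) * absval l) = absval (inverse (f x) - inverse l)"
    using ev
  proof eventually_elim
    case (elim x)
    then have "inverse (f x) - inverse l = (l - f x) / (f x * l)"
      using \<open>l \<noteq> 0\<close> by (simp add: field_simps)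
    then show ?case
      by (simp add: absval_divide absval_mult absval_minus_commute)
  qed
  with lim have "((\<lambda>x. absval (inverse (f x) - inverse l)) \<longlongrightarrow> 0) F"
    using Lim_transform_eventually by fastforce
  then show ?thesis
    using tendsto_absval_iff by blast
qed

lemma tendsto_divide_nonarch:
  fixes f g :: "'b \<Rightarrow> 'a :: nonarch_field"
  assumes "(f \<longlongrightarrow> l) F" "(g \<longlongrightarrow> m) F" "m \<noteq> 0"
  shows "((\<lambda>x. f x / g x) \<longlongrightarrow> l / m) F"
  using assms unfolding divide_inverse by (intro tendsto_mult tendsto_inverse_nonarch)

text \<open>X n - X M is a sum of consecutive differences, and the ultrametric inequality bounds it
  by the largest of them.\<close>

lemma nonarch_Cauchy_iff:
  fixes X :: "nat \<Rightarrow> 'a :: nonarch_field"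
  shows "Cauchy X \<longleftrightarrow> (\<lambda>n. X (Suc n) - X n) \<longlonglongrightarrow> 0"
proof
  assume C: "Cauchy X"
  show "(\<lambda>n. X (Suc n) - X n) \<longlonglongrightarrow> 0"
  proof (rule metric_LIMSEQ_I)
    fix r :: real assume "r > 0"
    then obtain M where "\<forall>m\<ge>M. \<forall>n\<ge>M. dist (X m) (X n) < r"
      using C unfolding Cauchy_def by blast
    then show "\<exists>no. \<forall>n\<ge>no. dist (X (Suc n) - X n) 0 < r"
      by (intro exI[of _ M]) (auto simp: dist_absval)
  qed
next
  assume L: "(\<lambda>n. X (Suc n) - X n) \<longlonglongrightarrow> 0"
  show "Cauchy X"
  proof (rule metric_CauchyI)
    fix e :: real assume "e > 0"
    then obtain M where M: "\<And>n. n \<ge> M \<Longrightarrow> absval (X (Suc n) - X n) < e"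
      using metric_LIMSEQ_D[OF L] by (auto simp: dist_absval)
    have *: "absval (X n - X M) < e" if "n \<ge> M" for n
      using that
    proof (induction n rule: dec_induct)
      case (step n)
      then show ?case
        using absval_add_less[of "X (Suc n) - X n" e "X n - X M"] M[of n] by simp
    qed (use \<open>e > 0\<close> in simp)
    have "dist (X m) (X n) < e" if "m \<ge> M" "n \<ge> M" for m n
      using absval_diff_less[OF *[OF that(1)] *[OF that(2)]] by (simp add: dist_absval)
    then show "\<exists>M. \<forall>m\<ge>M. \<forall>n\<ge>M. dist (X m) (X n) < e"
      by blast
  qed
qed

section \<open>Entire functions and their evaluation\<close>

text \<open>A bound on the Gauss norm sup |a_n| r^n, phrased so that the supremum never has to be
  formed.\<close>

definition gauss_bound :: "'a :: nonarch_field fps \<Rightarrow> real \<Rightarrow> real \<Rightarrow> bool" where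
  "gauss_bound A r M \<longleftrightarrow> (\<forall>n. absval (fps_nth A n) * r ^ n \<le> M)"

lemma gauss_boundD: "gauss_bound A r M \<Longrightarrow> absval (fps_nth A n) * r ^ n \<le> M"
  by (simp add: gauss_bound_def)

lemma gauss_bound_nonneg: "gauss_bound A r M \<Longrightarrow> M \<ge> 0"
  using gauss_boundD[of A r M 0] absval_nonneg[of "fps_nth A 0"] by simp

lemma gauss_bound_mono:
  assumes "gauss_bound A r M" "0 \<le> s" "s \<le> r" "M \<le> N"
  shows "gauss_bound A s N"
  unfolding gauss_bound_def
proof
  fix n
  have "absval (fps_nth A n) * s ^ n \<le> absval (fps_nth A n) * r ^ n"
    using assms by (intro mult_left_mono power_mono) (auto simp: absval_nonneg)
  also have "\<dots> \<le> M"
    using assms(1) by (rule gauss_boundD)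
  finally show "absval (fps_nth A n) * s ^ n \<le> N"
    using assms(4) by simp
qed

lemma gauss_bound_add:
  assumes "gauss_bound A r M" "gauss_bound B r M" "r \<ge> 0"
  shows "gauss_bound (A + B) r M"
  unfolding gauss_bound_def
proof
  fix n
  have "absval (fps_nth (A + B) n) * r ^ n
      \<le> max (absval (fps_nth A n)) (absval (fps_nth B n)) * r ^ n"
    using assms(3) by (intro mult_right_mono) (auto simp: absval_ultrametric)
  also have "\<dots> \<le> M"
    using gauss_boundD[OF assms(1), of n] gauss_boundD[OF assms(2), of n]
    by (auto simp: max_def)
  finally show "absval (fps_nth (A + B) n) * r ^ n \<le> M" .
qed

lemma gauss_bound_minus: "gauss_bound (- A) r M \<longleftrightarrow> gauss_bound A r M"
  by (simp add: gauss_bound_def)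

lemma gauss_bound_diff:
  assumes "gauss_bound A r M" "gauss_bound B r M" "r \<ge> 0"
  shows "gauss_bound (A - B) r M"
  using gauss_bound_add[of A r M "- B"] assms by (simp add: gauss_bound_minus)

lemma gauss_bound_mult:
  assumes A: "gauss_bound A r M" and B: "gauss_bound B r N" and r: "r \<ge> 0"
  shows "gauss_bound (A * B) r (M * N)"
  unfolding gauss_bound_def
proof
  fix n
  have "absval (fps_nth (A * B) n) * r ^ n = absval (\<Sum>i=0..n. fps_nth A i * fps_nth B (n - i)) * r ^ n"
    by (simp add: fps_mult_nth)
  also have "\<dots> \<le> M * N"
  \<comment> \<open>The estimate divides by r^n, which vanishes only for r = 0 and n > 0.\<close>
  proof (cases "r ^ n = 0")
    case False
    then have rn: "r ^ n > 0"
      using r by (metis less_eq_real_def zero_le_power)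
    have "absval (\<Sum>i=0..n. fps_nth A i * fps_nth B (n - i)) \<le> M * N / r ^ n"
    proof (rule absval_sum_le)
      fix i assume i: "i \<in> {0..n}"
      have "absval (fps_nth A i * fps_nth B (n - i)) * r ^ n
          = (absval (fps_nth A i) * r ^ i) * (absval (fps_nth B (n - i)) * r ^ (n - i))"
        using i by (simp add: absval_mult mult_ac flip: power_add)
      also have "\<dots> \<le> M * N"
        using gauss_boundD[OF A, of i] gauss_boundD[OF B, of "n - i"] gauss_bound_nonneg[OF A] r
        by (intro mult_mono) (auto simp: absval_nonneg)
      finally show "absval (fps_nth A i * fps_nth B (n - i)) \<le> M * N / r ^ n"
        using rn by (simp add: field_simps)
    qed (use gauss_bound_nonneg[OF A] gauss_bound_nonneg[OF B] rn in simp)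
    then show ?thesis
      using rn by (simp add: field_simps)
  next
    case True
    then show ?thesis
      using gauss_bound_nonneg[OF A] gauss_bound_nonneg[OF B] by (metis mult_nonneg_nonneg mult_zero_right)
  qed
  finally show "absval (fps_nth (A * B) n) * r ^ n \<le> M * N" .
qed

lemma gauss_bound_shift:
  assumes "gauss_bound A r M" "r > 0"
  shows "gauss_bound (fps_shift k A) r (M / r ^ k)"
  unfolding gauss_bound_def
proof
  fix n
  show "absval (fps_nth (fps_shift k A) n) * r ^ n \<le> M / r ^ k"
    using gauss_boundD[OF assms(1), of "n + k"] assms(2) by (simp add: field_simps power_add)
qed

lemma gauss_bound_of_poly: "\<exists>M. gauss_bound (fps_of_poly P) r M"
proof
  \<comment> \<open>The inserted 0 bounds the terms beyond the degree.\<close>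
  show "gauss_bound (fps_of_poly P) r (Max (insert 0 ((\<lambda>n. absval (coeff P n) * r ^ n) ` {..degree P})))"
    unfolding gauss_bound_def
  proof
    fix n
    show "absval (fps_nth (fps_of_poly P) n) * r ^ n
        \<le> Max (insert 0 ((\<lambda>n. absval (coeff P n) * r ^ n) ` {..degree P}))"
      by (cases "n \<le> degree P") (auto intro!: Max_ge simp: coeff_eq_0 simp del: Max_insert)
  qed
qed

section \<open>The ground field: completeness, a dense algebraically closed subfield, large absolute
  values\<close>

locale padic_complex_field =
  fixes p :: nat and ty :: "'a :: nonarch_field itself"
  assumes prime_p: "prime p" and padic_complex: "is_padic_complex_field p ty"
begin

lemma absval_p: "absval (of_nat p :: 'a) = 1 / real p"
proof -
  have "absval (of_rat (of_nat p) :: 'a) = padic_abs p (of_nat p)"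
    using padic_complex unfolding is_padic_complex_field_def by blast
  moreover have "quotient_of (of_nat p) = (int p, 1)"
    using quotient_of_int[of "int p"] by simp
  moreover have "multiplicity (int p) (int p) = 1"
    using prime_p by (intro multiplicity_self) auto
  ultimately show ?thesis
    using prime_gt_0_nat[OF prime_p]
    by (simp add: padic_abs_def power_int_def inverse_eq_divide)
qed

lemma complete_UNIV: "complete (UNIV :: 'a set)"
  using padic_complex unfolding is_padic_complex_field_def completion_of_def by blast

text \<open>The definition provides algebraic closedness for \<open>L\<close>, not for its
  completion. Roots are therefore taken only of polynomials over \<open>L\<close>, and the rest is
  reached by density.\<close>

lemma ex_algebraically_closed_dense:
  obtains L :: "'a set" where "is_subfield L" "closure L = UNIV"
    "\<And>P. poly_over L P \<Longrightarrow> degree P > 0 \<Longrightarrow> \<exists>x\<in>L. poly P x = 0"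
proof -
  obtain K L :: "'a set" where "is_subfield L" "algebraic_closure_of L K" "completion_of UNIV L"
    using padic_complex unfolding is_padic_complex_field_def by blast
  then show ?thesis
    using that[of L] unfolding algebraic_closure_of_def completion_of_def by blast
qed

lemma Cauchy_nonarch_convergent:
  fixes X :: "nat \<Rightarrow> 'a"
  assumes "(\<lambda>n. X (Suc n) - X n) \<longlonglongrightarrow> 0"
  shows "convergent X"
  using complete_UNIV assms
  unfolding complete_def convergent_def nonarch_Cauchy_iff[symmetric] by auto

lemma ex_absval_gt: "\<exists>c :: 'a. absval c > r"
proof -
  have "1 < real p"
    using prime_gt_1_nat[OF prime_p] by simp
  then obtain n where "r < real p ^ n"
    using real_arch_pow by blast
  then have "absval (inverse (of_nat p) ^ n :: 'a) > r"
    by (simp add: absval_power absval_inverse absval_p)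
  then show ?thesis by blast
qed

text \<open>Some x has |x| > r, and the terms of the series at x are bounded, which bounds those at
  r. Conversely a bound at a radius above |x| makes the terms at x decay geometrically, and in a
  complete ultrametric field terms tending to 0 suffice for convergence.\<close>

lemma entire_iff: "entire (A :: 'a fps) \<longleftrightarrow> (\<forall>r>0. \<exists>M. gauss_bound A r M)"
proof (intro iffI allI impI)
  fix r :: real
  assume A: "entire A" and r: "r > 0"
  obtain x :: 'a where x: "absval x > r"
    using ex_absval_gt by blast
  obtain s where "(\<lambda>n. \<Sum>i<n. fps_nth A i * x ^ i) \<longlonglongrightarrow> s"
    using A unfolding entire_def summable_def sums_def by blast
  then have "(\<lambda>n. (\<Sum>i<Suc n. fps_nth A i * x ^ i) - (\<Sum>i<n. fps_nth A i * x ^ i)) \<longlonglongrightarrow> s - s"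
    by (intro tendsto_diff LIMSEQ_Suc)
  then have "(\<lambda>n. absval (fps_nth A n * x ^ n)) \<longlonglongrightarrow> 0"
    using tendsto_absval[of _ 0] by simp
  then have "Bseq (\<lambda>n. absval (fps_nth A n * x ^ n))"
    by (rule convergent_imp_Bseq[OF convergentI])
  then obtain M where M: "\<And>n. absval (fps_nth A n * x ^ n) \<le> M"
    by (auto simp: Bseq_def absval_nonneg)
  then have "gauss_bound A (absval x) M"
    by (simp add: gauss_bound_def absval_mult absval_power)
  then show "\<exists>M. gauss_bound A r M"
    using x r gauss_bound_mono[of A "absval x" M r M] by auto
next
  assume A: "\<forall>r>0. \<exists>M. gauss_bound A r M"
  show "entire A"
    unfolding entire_def
  proof
    fix x :: 'a
    \<comment> \<open>Any radius above |x| would do; the summand 1 keeps it positive when x =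
      0.\<close>
    define r where "r = 2 * absval x + 1"
    have r: "r > 0" "absval x / r < 1" "absval x / r \<ge> 0"
      using absval_nonneg[of x] by (auto simp: r_def)
    obtain M where M: "gauss_bound A r M"
      using A r by blast
    have "(\<lambda>n. M * (absval x / r) ^ n) \<longlonglongrightarrow> M * 0"
      using r by (intro tendsto_mult tendsto_const LIMSEQ_realpow_zero)
    then have lim: "(\<lambda>n. M * (absval x / r) ^ n) \<longlonglongrightarrow> 0"
      by simp
    have "(\<lambda>n. absval (fps_nth A n * x ^ n - 0)) \<longlonglongrightarrow> 0"
    proof (rule Lim_null_comparison[OF always_eventually lim], intro allI)
      fix n
      have "absval (fps_nth A n) * absval x ^ n = (absval (fps_nth A n) * r ^ n) * (absval x / r) ^ n"
        using r by (simp add: power_divide)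
      also have "\<dots> \<le> M * (absval x / r) ^ n"
        using M r by (intro mult_right_mono gauss_boundD) auto
      finally show "norm (absval (fps_nth A n * x ^ n - 0)) \<le> M * (absval x / r) ^ n"
        by (simp add: absval_mult absval_power absval_nonneg)
    qed
    then have "(\<lambda>n. fps_nth A n * x ^ n) \<longlonglongrightarrow> 0"
      using tendsto_absval_iff[of "\<lambda>n. fps_nth A n * x ^ n" 0] by blast
    then have "convergent (\<lambda>n. \<Sum>i<n. fps_nth A i * x ^ i)"
      by (intro Cauchy_nonarch_convergent) simp
    then show "summable (\<lambda>n. fps_nth A n * x ^ n)"
      by (simp add: summable_iff_convergent)
  qed
qed

lemma entire_gauss_bound:
  assumes "entire (A :: 'a fps)" "r \<ge> 0"
  shows "\<exists>M. gauss_bound A r M"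
proof -
  obtain M where "gauss_bound A (r + 1) M"
    using assms entire_iff by (metis add_nonneg_pos zero_less_one)
  then show ?thesis
    using gauss_bound_mono[of A "r + 1" M r M] assms by auto
qed

lemma entire_terms_tendsto_0:
  assumes "entire (A :: 'a fps)" "r \<ge> 0"
  shows "(\<lambda>n. absval (fps_nth A n) * r ^ n) \<longlonglongrightarrow> 0"
proof -
  define s where "s = 2 * r + 1"
  have s: "s > 0" "r / s < 1" "r / s \<ge> 0"
    using assms(2) by (auto simp: s_def)
  obtain M where M: "gauss_bound A s M"
    using entire_gauss_bound[OF assms(1), of s] s by auto
  have "(\<lambda>n. M * (r / s) ^ n) \<longlonglongrightarrow> M * 0"
    using s by (intro tendsto_mult tendsto_const LIMSEQ_realpow_zero)
  then have lim: "(\<lambda>n. M * (r / s) ^ n) \<longlonglongrightarrow> 0"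
    by simp
  show ?thesis
  proof (rule Lim_null_comparison[OF always_eventually lim], intro allI)
    fix n
    have "absval (fps_nth A n) * r ^ n = (absval (fps_nth A n) * s ^ n) * (r / s) ^ n"
      using s by (simp add: power_divide)
    also have "\<dots> \<le> M * (r / s) ^ n"
      using M s by (intro mult_right_mono gauss_boundD) auto
    finally show "norm (absval (fps_nth A n) * r ^ n) \<le> M * (r / s) ^ n"
      using assms(2) by (simp add: absval_nonneg)
  qed
qed

section \<open>Closure properties of entire series\<close>

lemma entire_add: "entire (A :: 'a fps) \<Longrightarrow> entire B \<Longrightarrow> entire (A + B)"
  unfolding entire_iff
proof (intro allI impI)
  fix r :: real
  assume "\<forall>r>0. \<exists>M. gauss_bound A r M" "\<forall>r>0. \<exists>M. gauss_bound B r M" and r: "r > 0"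
  then obtain M N where "gauss_bound A r M" "gauss_bound B r N"
    by blast
  then have "gauss_bound A r (max M N)" "gauss_bound B r (max M N)"
    using r gauss_bound_mono[of A r M r "max M N"] gauss_bound_mono[of B r N r "max M N"] by auto
  then show "\<exists>M. gauss_bound (A + B) r M"
    using r by (intro exI gauss_bound_add) auto
qed

lemma entire_minus: "entire (A :: 'a fps) \<Longrightarrow> entire (- A)"
  by (simp add: entire_iff gauss_bound_minus)

lemma entire_diff: "entire (A :: 'a fps) \<Longrightarrow> entire B \<Longrightarrow> entire (A - B)"
  using entire_add[of A "- B"] entire_minus[of B] by simp

lemma entire_mult: "entire (A :: 'a fps) \<Longrightarrow> entire B \<Longrightarrow> entire (A * B)"
  unfolding entire_iff using gauss_bound_mult by (meson less_eq_real_def)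

lemma entire_of_poly: "entire (fps_of_poly P :: 'a fps)"
  by (simp add: entire_iff gauss_bound_of_poly)

lemma entire_const [simp]: "entire (fps_const (c :: 'a))"
  using entire_of_poly[of "[:c:]"] by (simp add: fps_of_poly_const)

lemma entire_0 [simp]: "entire (0 :: 'a fps)"
  using entire_const[of 0] by simp

lemma entire_1 [simp]: "entire (1 :: 'a fps)"
  using entire_const[of 1] by simp

lemma entire_X [simp]: "entire (fps_X :: 'a fps)"
  using entire_of_poly[of "[:0, 1:]"] by simp

lemma entire_power: "entire (A :: 'a fps) \<Longrightarrow> entire (A ^ n)"
  by (induction n) (auto intro: entire_mult)

lemma entire_shift:
  assumes "entire (A :: 'a fps)"
  shows "entire (fps_shift k A)"
  unfolding entire_iff
proof (intro allI impI)
  fix r :: real assume r: "r > 0"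
  then obtain M where M: "gauss_bound A r M"
    using assms entire_iff by blast
  then show "\<exists>M. gauss_bound (fps_shift k A) r M"
    using gauss_bound_shift r by blast
qed

section \<open>Evaluation of entire series\<close>

lemma entire_eval_sums:
  assumes "entire (A :: 'a fps)"
  shows "(\<lambda>n. fps_nth A n * x ^ n) sums entire_eval A x"
  using assms unfolding entire_def entire_eval_def by (blast intro: summable_sums)

lemma entire_eval_add:
  "entire (A :: 'a fps) \<Longrightarrow> entire B \<Longrightarrow> entire_eval (A + B) x = entire_eval A x + entire_eval B x"
  using sums_unique[OF sums_add[OF entire_eval_sums[of A x] entire_eval_sums[of B x]]]
  by (simp add: entire_eval_def algebra_simps)

lemma entire_eval_minus: "entire (A :: 'a fps) \<Longrightarrow> entire_eval (- A) x = - entire_eval A x"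
proof -
  assume A: "entire A"
  have "entire_eval (A + - A) x = entire_eval A x + entire_eval (- A) x"
    using A entire_minus by (intro entire_eval_add) auto
  then show ?thesis
    by (simp add: entire_eval_def add_eq_0_iff)
qed

lemma entire_eval_diff:
  "entire (A :: 'a fps) \<Longrightarrow> entire B \<Longrightarrow> entire_eval (A - B) x = entire_eval A x - entire_eval B x"
  using entire_eval_add[of A "- B"] by (simp add: entire_eval_minus entire_minus)

lemma entire_eval_of_poly: "entire_eval (fps_of_poly P) x = poly P (x :: 'a)"
proof -
  have "(\<lambda>n. fps_nth (fps_of_poly P) n * x ^ n) sums (\<Sum>n\<le>degree P. fps_nth (fps_of_poly P) n * x ^ n)"
    by (intro sums_finite) (auto simp: coeff_eq_0)
  then show ?thesis
    by (simp add: entire_eval_def poly_altdef sums_iff)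
qed

lemma entire_eval_const [simp]: "entire_eval (fps_const c) x = (c :: 'a)"
  using entire_eval_of_poly[of "[:c:]" x] by (simp add: fps_of_poly_const)

lemma entire_eval_0 [simp]: "entire_eval 0 x = (0 :: 'a)"
  using entire_eval_const[of 0 x] by simp

lemma entire_eval_1 [simp]: "entire_eval 1 x = (1 :: 'a)"
  using entire_eval_const[of 1 x] by simp

lemma entire_eval_X [simp]: "entire_eval fps_X x = (x :: 'a)"
  using entire_eval_of_poly[of "[:0, 1:]" x] by simp

lemma entire_eval_at_0: "entire_eval (A :: 'a fps) 0 = fps_nth A 0"
proof -
  have "(\<lambda>n. fps_nth A n * 0 ^ n) sums (\<Sum>n\<in>{0}. fps_nth A n * 0 ^ n)"
    by (intro sums_finite) auto
  then show ?thesis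
    by (simp add: entire_eval_def sums_iff)
qed

lemma absval_entire_eval_le:
  assumes "entire (A :: 'a fps)" "gauss_bound A (absval x) M"
  shows "absval (entire_eval A x) \<le> M"
proof (rule LIMSEQ_le_const2)
  show "(\<lambda>n. absval (\<Sum>i<n. fps_nth A i * x ^ i)) \<longlonglongrightarrow> absval (entire_eval A x)"
    using entire_eval_sums[OF assms(1)] unfolding sums_def by (rule tendsto_absval)
  have "absval (\<Sum>i<n. fps_nth A i * x ^ i) \<le> M" for n
    using gauss_boundD[OF assms(2)] gauss_bound_nonneg[OF assms(2)]
    by (intro absval_sum_le) (auto simp: absval_mult absval_power)
  then show "\<exists>N. \<forall>n\<ge>N. absval (\<Sum>i<n. fps_nth A i * x ^ i) \<le> M"
    by blast
qed

lemma entire_poly_approx: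
  assumes "entire (A :: 'a fps)" "r \<ge> 0" "e > 0"
  shows "\<exists>P. gauss_bound (A - fps_of_poly P) r e"
proof -
  obtain N where N: "\<And>n. n \<ge> N \<Longrightarrow> absval (fps_nth A n) * r ^ n < e"
    using order_tendstoD(2)[OF entire_terms_tendsto_0[OF assms(1,2)] assms(3)]
    by (auto simp: eventually_sequentially)
  have "gauss_bound (A - fps_of_poly (Poly (map (fps_nth A) [0..<N]))) r e"
    unfolding gauss_bound_def
    using N assms by (auto simp: nth_default_def less_imp_le not_less)
  then show ?thesis ..
qed

text \<open>Multiplicativity is transferred from polynomials. If the two sides differed by d > 0 in
  absolute value, both factors could be replaced by polynomials e-close in the Gauss norm; this
  moves each side by at most e K < d, while for polynomials the sides agree.\<close>

lemma entire_eval_mult: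
  assumes A: "entire (A :: 'a fps)" and B: "entire B"
  shows "entire_eval (A * B) x = entire_eval A x * entire_eval B x"
proof (rule ccontr)
  let ?r = "absval x"
  define d where "d = absval (entire_eval (A * B) x - entire_eval A x * entire_eval B x)"
  assume "entire_eval (A * B) x \<noteq> entire_eval A x * entire_eval B x"
  then have d: "d > 0"
    by (simp add: d_def)
  obtain M N where M: "gauss_bound A ?r M" and N: "gauss_bound B ?r N"
    using A B entire_gauss_bound absval_nonneg by meson
  define K where "K = max 1 (max M N)"
  have K: "gauss_bound A ?r K" "gauss_bound B ?r K" "K \<ge> 1"
    using gauss_bound_mono[OF M, of ?r K] gauss_bound_mono[OF N, of ?r K]
    by (auto simp: K_def absval_nonneg)
  \<comment> \<open>e <= K keeps the approximating polynomial within the bound K; e K < d is what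
    the final contradiction needs.\<close>
  define e where "e = min K (d / (2 * K))"
  have e: "e > 0" "e \<le> K" "e * K < d"
    using d K(3) by (auto simp: e_def min_def field_simps)
  obtain P Q where P: "gauss_bound (A - fps_of_poly P) ?r e" and Q: "gauss_bound (B - fps_of_poly Q) ?r e"
    using A B e entire_poly_approx absval_nonneg by meson
  have "gauss_bound (A - (A - fps_of_poly P)) ?r K"
    using K e absval_nonneg[of x] by (intro gauss_bound_diff gauss_bound_mono[OF P]) auto
  then have P': "gauss_bound (fps_of_poly P) ?r K"
    by simp
  note ent = A B entire_of_poly entire_mult entire_diff
  have le1: "gauss_bound ((A - fps_of_poly P) * B) ?r (e * K)"
    using P K by (intro gauss_bound_mult) (auto simp: absval_nonneg)
  have le2: "gauss_bound (fps_of_poly P * (B - fps_of_poly Q)) ?r (e * K)"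
    using gauss_bound_mult[OF P' Q] by (simp add: absval_nonneg mult.commute)
  have "gauss_bound ((A - fps_of_poly P) * B + fps_of_poly P * (B - fps_of_poly Q)) ?r (e * K)"
    using le1 le2 by (intro gauss_bound_add) (auto simp: absval_nonneg)
  moreover have "(A - fps_of_poly P) * B + fps_of_poly P * (B - fps_of_poly Q)
      = A * B - fps_of_poly (P * Q)"
    by (simp add: algebra_simps fps_of_poly_mult)
  ultimately have "absval (entire_eval (A * B - fps_of_poly (P * Q)) x) \<le> e * K"
    by (intro absval_entire_eval_le) (auto intro!: ent)
  then have 1: "absval (entire_eval (A * B) x - poly P x * poly Q x) \<le> e * K"
    by (simp add: entire_eval_diff entire_eval_of_poly ent)
  have a: "absval (entire_eval A x - poly P x) \<le> e"
    using absval_entire_eval_le[OF _ P] by (simp add: entire_eval_diff entire_eval_of_poly ent)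
  have b: "absval (entire_eval B x - poly Q x) \<le> e"
    using absval_entire_eval_le[OF _ Q] by (simp add: entire_eval_diff entire_eval_of_poly ent)
  have c: "absval (entire_eval B x) \<le> K" "absval (poly P x) \<le> K"
    using absval_entire_eval_le[OF B K(2)] absval_entire_eval_le[OF entire_of_poly P']
    by (simp_all add: entire_eval_of_poly)
  have "absval ((entire_eval A x - poly P x) * entire_eval B x) \<le> e * K"
    unfolding absval_mult using a c e by (intro mult_mono) (auto simp: absval_nonneg)
  moreover have "absval (poly P x * (entire_eval B x - poly Q x)) \<le> e * K"
    unfolding absval_mult using mult_mono[OF c(2) b] K(3) by (simp add: absval_nonneg mult.commute)
  moreover have "entire_eval A x * entire_eval B x - poly P x * poly Q x
      = (entire_eval A x - poly P x) * entire_eval B x + poly P x * (entire_eval B x - poly Q x)"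
    by (simp add: algebra_simps)
  ultimately have 2: "absval (entire_eval A x * entire_eval B x - poly P x * poly Q x) \<le> e * K"
    by (simp add: absval_add_le)
  have "d \<le> e * K"
    using absval_diff_le[OF 1 2] by (simp add: d_def)
  with e show False by simp
qed

lemma entire_eval_power: "entire (A :: 'a fps) \<Longrightarrow> entire_eval (A ^ n) x = entire_eval A x ^ n"
  by (induction n) (simp_all add: entire_eval_mult entire_power)

lemma entire_eval_linear [simp]: "entire_eval (fps_X - fps_const c) x = x - (c :: 'a)"
  by (simp add: entire_eval_diff)

lemma entire_linear [simp]: "entire (fps_X - fps_const (c :: 'a))"
  by (simp add: entire_diff)

lemma linear_fps_neq_0 [simp]: "fps_X - fps_const c \<noteq> (0 :: 'b :: comm_ring_1 fps)"
  by (auto simp: fps_eq_iff intro!: exI[of _ 1])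

lemma entire_divide_linear:
  assumes A: "entire (A :: 'a fps)"
  obtains B where "entire B" "A - fps_const (entire_eval A c) = (fps_X - fps_const c) * B"
proof
  \<comment> \<open>Synthetic division carried to infinity: coefficient n of the quotient is the
    tail sum of a_j c^(j - n - 1) over j > n.\<close>
  define B where "B = Abs_fps (\<lambda>n. entire_eval (fps_shift (Suc n) A) c)"
  have shift: "entire_eval (fps_shift n A) c = fps_nth A n + c * entire_eval (fps_shift (Suc n) A) c" for n
  proof -
    have "fps_shift n A = fps_const (fps_nth A n) + fps_X * fps_shift (Suc n) A"
      by (rule fps_ext) simp
    then have "entire_eval (fps_shift n A) c = entire_eval (fps_const (fps_nth A n) + fps_X * fps_shift (Suc n) A) c"
      by simp
    then show ?thesis
      using A by (simp add: entire_eval_add entire_mult entire_shift entire_eval_mult)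
  qed
  show "A - fps_const (entire_eval A c) = (fps_X - fps_const c) * B"
  proof (rule fps_ext)
    fix n
    show "fps_nth (A - fps_const (entire_eval A c)) n = fps_nth ((fps_X - fps_const c) * B) n"
      using shift[of n] by (cases n) (auto simp: B_def algebra_simps)
  qed
  show "entire B"
    unfolding entire_iff
  proof (intro allI impI)
    fix r :: real assume "r > 0"
    \<comment> \<open>The coefficients of \<open>B\<close> are values at c, so the bound on
      \<open>A\<close> is taken at a radius that covers both r and |c|.\<close>
    define R where "R = max r (absval c)"
    have R: "R > 0" "r \<le> R" "absval c \<le> R"
      using \<open>r > 0\<close> by (auto simp: R_def)
    obtain M where M: "gauss_bound A R M"
      using A R entire_iff by blast
    have "gauss_bound B R (M / R)"
      unfolding gauss_bound_def
    proof
      fix n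
      have "gauss_bound (fps_shift (Suc n) A) R (M / R ^ Suc n)"
        using M R by (intro gauss_bound_shift)
      then have "gauss_bound (fps_shift (Suc n) A) (absval c) (M / R ^ Suc n)"
        by (rule gauss_bound_mono) (use R in \<open>auto simp: absval_nonneg\<close>)
      then have "absval (fps_nth B n) \<le> M / R ^ Suc n"
        unfolding B_def using A by (simp del: power_Suc add: absval_entire_eval_le entire_shift)
      then show "absval (fps_nth B n) * R ^ n \<le> M / R"
        using R by (simp add: field_simps)
    qed
    then show "\<exists>M. gauss_bound B r M"
      using R \<open>r > 0\<close> gauss_bound_mono[of B R "M / R" r "M / R"] by auto
  qed
qed

lemma entire_zero_factor:
  assumes "entire (A :: 'a fps)" "entire_eval A c = 0"
  obtains B where "entire B" "A = (fps_X - fps_const c) * B"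
  using entire_divide_linear[OF assms(1), of c] assms(2) by auto

text \<open>A x - A c = (x - c) B x with B entire, hence bounded near c.\<close>

lemma tendsto_entire_eval:
  assumes A: "entire (A :: 'a fps)" and y: "(y \<longlongrightarrow> c) F"
  shows "((\<lambda>x. entire_eval A (y x)) \<longlongrightarrow> entire_eval A c) F"
proof -
  obtain B where B: "entire B" "A - fps_const (entire_eval A c) = (fps_X - fps_const c) * B"
    using entire_divide_linear[OF A] by blast
  have *: "entire_eval A x - entire_eval A c = (x - c) * entire_eval B x" for x
  proof -
    have "entire_eval (A - fps_const (entire_eval A c)) x = entire_eval ((fps_X - fps_const c) * B) x"
      by (simp add: B)
    then show ?thesis
      using A B(1) by (simp add: entire_eval_diff entire_eval_mult)
  qed
  obtain M where M: "gauss_bound B (absval c + 1) M"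
    using entire_gauss_bound[OF B(1), of "absval c + 1"] absval_nonneg[of c] by auto
  have lim: "((\<lambda>x. absval (y x - c)) \<longlongrightarrow> 0) F"
    using y tendsto_absval_iff by blast
  have ev: "\<forall>\<^sub>F x in F. norm (absval (entire_eval A (y x) - entire_eval A c)) \<le> absval (y x - c) * M"
    using order_tendstoD(2)[OF lim zero_less_one]
  proof eventually_elim
    case (elim x)
    then have "absval (y x) \<le> absval c + 1"
      using absval_triangle[of "y x" c] by linarith
    then have "absval (entire_eval B (y x)) \<le> M"
      using B(1) M by (intro absval_entire_eval_le gauss_bound_mono[OF M]) (auto simp: absval_nonneg)
    then show ?case
      by (simp add: * absval_mult absval_nonneg mult_left_mono)
  qed
  have "((\<lambda>x. absval (y x - c) * M) \<longlongrightarrow> 0) F"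
    using lim by (rule tendsto_mult_left_zero)
  then have "((\<lambda>x. absval (entire_eval A (y x) - entire_eval A c)) \<longlongrightarrow> 0) F"
    by (rule Lim_null_comparison[OF ev])
  then show ?thesis
    using tendsto_absval_iff by blast
qed

end

section \<open>Dominant indices\<close>

text \<open>For r > 0 these are the indices of the points (n, -log |a_n|) of the Newton polygon that
  lie on its supporting line of slope log r.\<close>

definition dominant_indices :: "'a :: nonarch_field fps \<Rightarrow> real \<Rightarrow> nat set" where
  "dominant_indices A r =
     {n. \<forall>i. absval (fps_nth A i) * r ^ i \<le> absval (fps_nth A n) * r ^ n}"

definition strictly_dominant :: "'a :: nonarch_field fps \<Rightarrow> real \<Rightarrow> nat \<Rightarrow> bool" where
  "strictly_dominant A r n \<longleftrightarrow>
     (\<forall>i. i \<noteq> n \<longrightarrow> absval (fps_nth A i) * r ^ i < absval (fps_nth A n) * r ^ n)"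

lemma dominant_indicesD:
  "n \<in> dominant_indices A r \<Longrightarrow> absval (fps_nth A i) * r ^ i \<le> absval (fps_nth A n) * r ^ n"
  by (simp add: dominant_indices_def)

lemma dominant_indices_nth_neq_0:
  assumes "A \<noteq> 0" "r > 0" "n \<in> dominant_indices A r"
  shows "fps_nth A n \<noteq> 0"
proof
  assume 0: "fps_nth A n = 0"
  obtain i where i: "fps_nth A i \<noteq> 0"
    using assms(1) by (auto simp: fps_eq_iff)
  have "absval (fps_nth A i) * r ^ i > 0"
    using i assms(2) by simp
  then show False
    using dominant_indicesD[OF assms(3), of i] 0 by simp
qed

lemma not_dominant_index_less:
  assumes "n \<in> dominant_indices A r" "i \<notin> dominant_indices A r"
  shows "absval (fps_nth A i) * r ^ i < absval (fps_nth A n) * r ^ n"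
  using assms unfolding dominant_indices_def mem_Collect_eq by (meson order_trans not_le)

lemma dominant_indices_eq_value:
  assumes "n \<in> dominant_indices A r" "m \<in> dominant_indices A r"
  shows "absval (fps_nth A n) * r ^ n = absval (fps_nth A m) * r ^ m"
  using assms by (intro antisym dominant_indicesD)

text \<open>Moving from radius r to s multiplies the term of index i by \<open>(s / r) ^ i\<close>.
  For s < r this favours smaller indices, for s > r larger ones.\<close>

lemma scaled_dominant_less:
  fixes r s :: real
  assumes "0 < r" "0 < s" "a * r ^ i \<le> b * r ^ n" "b > 0" "(s / r) ^ i < (s / r) ^ n"
  shows "a * s ^ i < b * s ^ n"
proof -
  have "a * s ^ i = a * r ^ i * (s / r) ^ i"
    using assms by (simp add: power_divide)
  also have "\<dots> \<le> b * r ^ n * (s / r) ^ i"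
    using assms by (intro mult_right_mono) auto
  also have "\<dots> < b * r ^ n * (s / r) ^ n"
    using assms by (intro mult_strict_left_mono) auto
  also have "\<dots> = b * s ^ n"
    using assms by (simp add: power_divide)
  finally show ?thesis .
qed

lemma eventually_scaled_less:
  fixes R :: real
  assumes "a * R ^ i < b * R ^ n"
  shows "\<forall>\<^sub>F r in at R within S. a * r ^ i < b * r ^ n"
proof -
  have "((\<lambda>r. b * r ^ n - a * r ^ i) \<longlongrightarrow> b * R ^ n - a * R ^ i) (at R within S)"
    by (intro tendsto_intros)
  then have "\<forall>\<^sub>F r in at R within S. b * r ^ n - a * r ^ i > 0"
    using assms by (intro order_tendstoD(1)) auto
  then show ?thesis
    by (rule eventually_mono) simp
qed

context padic_complex_field
begin

text \<open>The terms tend to 0, so only finitely many of them reach the size of a fixed nonzero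
  one.\<close>

lemma dominant_indices_finite_nonempty:
  assumes "entire (A :: 'a fps)" "A \<noteq> 0" "r > 0"
  shows "finite (dominant_indices A r)" "dominant_indices A r \<noteq> {}"
proof -
  let ?t = "\<lambda>n. absval (fps_nth A n) * r ^ n"
  obtain k where k: "fps_nth A k \<noteq> 0"
    using assms(2) by (auto simp: fps_eq_iff)
  then have pos: "?t k > 0"
    using assms(3) by simp
  then obtain N where N: "\<And>n. n \<ge> N \<Longrightarrow> ?t n < ?t k"
    using order_tendstoD(2)[OF entire_terms_tendsto_0[OF assms(1), of r] pos] assms(3)
    by (auto simp: eventually_sequentially)
  have "dominant_indices A r \<subseteq> {..<N}"
  proof
    fix n assume "n \<in> dominant_indices A r"
    then have "\<not> ?t n < ?t k"
      using dominant_indicesD[of n A r k] by simp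
    then show "n \<in> {..<N}"
      using N[of n] not_le by blast
  qed
  then show "finite (dominant_indices A r)"
    by (rule finite_subset) simp
  have "k < N"
    using N[of k] less_irrefl[of "?t k"] not_le by blast
  then have "finite (?t ` {..<N})" "?t ` {..<N} \<noteq> {}"
    by auto
  then have "Max (?t ` {..<N}) \<in> ?t ` {..<N}"
    by (rule Max_in)
  then obtain n where n: "n < N" "?t n = Max (?t ` {..<N})"
    by (elim imageE) simp
  have "?t i \<le> ?t n" for i
  proof (cases "i < N")
    case True
    then show ?thesis
      unfolding n(2) by (intro Max_ge) auto
  next
    case False
    then have "?t i < ?t k"
      using N by simp
    also have "?t k \<le> ?t n"
      unfolding n(2) using \<open>k < N\<close> by (intro Max_ge) auto
    finally show ?thesis by simp
  qed
  then have "n \<in> dominant_indices A r"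
    by (simp add: dominant_indices_def)
  then show "dominant_indices A r \<noteq> {}" by blast
qed

text \<open>In every partial sum that contains it, the dominant term exceeds the sum of the others,
  so all these partial sums have the same absolute value.\<close>

lemma absval_entire_eval_strictly_dominant:
  assumes A: "entire (A :: 'a fps)" and n: "strictly_dominant A (absval x) n"
  shows "absval (entire_eval A x) = absval (fps_nth A n) * absval x ^ n"
proof (rule LIMSEQ_unique)
  let ?s = "\<lambda>N. absval (\<Sum>i<N. fps_nth A i * x ^ i)"
  show "?s \<longlonglongrightarrow> absval (entire_eval A x)"
    using entire_eval_sums[OF A] unfolding sums_def by (rule tendsto_absval)
  have "?s N = absval (fps_nth A n) * absval x ^ n" if "N > n" for N
  proof -
    have "(\<Sum>i<N. fps_nth A i * x ^ i) = fps_nth A n * x ^ n + (\<Sum>i\<in>{..<N} - {n}. fps_nth A i * x ^ i)"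
      using that by (intro sum.remove) auto
    moreover have "absval (\<Sum>i\<in>{..<N} - {n}. fps_nth A i * x ^ i) < absval (fps_nth A n * x ^ n)"
    proof (rule absval_sum_less)
      \<comment> \<open>The maximal term is positive because it strictly exceeds some other term,
        here the next one.\<close>
      have "0 \<le> absval (fps_nth A (Suc n)) * absval x ^ Suc n"
        by (intro mult_nonneg_nonneg zero_le_power absval_nonneg)
      also have "\<dots> < absval (fps_nth A n) * absval x ^ n"
        using n unfolding strictly_dominant_def by (metis n_not_Suc_n)
      finally show "absval (fps_nth A n * x ^ n) > 0"
        by (simp add: absval_mult absval_power del: absval_pos_iff)
    qed (use n in \<open>auto simp: strictly_dominant_def absval_mult absval_power\<close>)
    ultimately show ?thesis
      by (simp add: absval_add_eq absval_mult absval_power)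
  qed
  then have "\<forall>\<^sub>F N in sequentially. absval (fps_nth A n) * absval x ^ n = ?s N"
    by (intro eventually_mono[OF eventually_gt_at_top[of n]]) auto
  then show "?s \<longlonglongrightarrow> absval (fps_nth A n) * absval x ^ n"
    by (rule Lim_transform_eventually[OF tendsto_const])
qed

text \<open>Indices below the minimum lose strictly at R and, being finitely many, still lose nearby
  by continuity. Larger indices at best tie at R and lose when the radius shrinks.\<close>

lemma eventually_strictly_dominant_left:
  assumes A: "entire (A :: 'a fps)" "A \<noteq> 0" and R: "R > 0"
  shows "\<forall>\<^sub>F r in at_left R. strictly_dominant A r (Min (dominant_indices A R))"
proof -
  define n where "n = Min (dominant_indices A R)"
  have n: "n \<in> dominant_indices A R" "\<And>i. i < n \<Longrightarrow> i \<notin> dominant_indices A R"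
    using dominant_indices_finite_nonempty[OF A R] Min_in Min_le by (auto simp: n_def leD)
  have pos: "absval (fps_nth A n) > 0"
    using dominant_indices_nth_neq_0[OF A(2) R n(1)] by simp
  have "\<forall>\<^sub>F r in at_left R. \<forall>i\<in>{..<n}. absval (fps_nth A i) * r ^ i < absval (fps_nth A n) * r ^ n"
    using n by (intro eventually_ball_finite ballI eventually_scaled_less)
      (auto intro: not_dominant_index_less)
  moreover have "\<forall>\<^sub>F r in at_left R. 0 < r \<and> r < R"
    using R by (auto simp: eventually_at_left)
  ultimately show ?thesis
    unfolding n_def[symmetric] strictly_dominant_def
  proof eventually_elim
    case (elim r)
    show ?case
    proof (intro allI impI)
      fix i assume "i \<noteq> n"
      then consider "i < n" | "n < i" by linarith
      then show "absval (fps_nth A i) * r ^ i < absval (fps_nth A n) * r ^ n"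
      proof cases
        case 2
        have "(r / R) ^ i < (r / R) ^ n"
          using 2 elim by (intro power_strict_decreasing) auto
        then show ?thesis
          using n pos elim by (intro scaled_dominant_less[of R]) (auto intro: dominant_indicesD)
      qed (use elim in auto)
    qed
  qed
qed

text \<open>The mirror image, with one difference: infinitely many indices now lie on the side
  treated by continuity, so all but finitely many of them have to be beaten uniformly.\<close>

lemma eventually_strictly_dominant_right:
  assumes A: "entire (A :: 'a fps)" "A \<noteq> 0" and R: "R > 0"
  shows "\<forall>\<^sub>F r in at_right R. strictly_dominant A r (Max (dominant_indices A R))"
proof -
  define n where "n = Max (dominant_indices A R)"
  have n: "n \<in> dominant_indices A R" "\<And>i. i > n \<Longrightarrow> i \<notin> dominant_indices A R"
    using dominant_indices_finite_nonempty[OF A R] Max_in Max_ge by (auto simp: n_def leD)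
  have pos: "absval (fps_nth A n) > 0"
    using dominant_indices_nth_neq_0[OF A(2) R n(1)] by simp
  then have "absval (fps_nth A n) * R ^ n > 0"
    using R by simp
  \<comment> \<open>Indices from \<open>N\<close> on lose on all of (R, 2 R): even at 2 R their
    terms are below the dominant term at R.\<close>
  then obtain N where N: "\<And>i. i \<ge> N \<Longrightarrow> absval (fps_nth A i) * (2 * R) ^ i < absval (fps_nth A n) * R ^ n"
    using order_tendstoD(2)[OF entire_terms_tendsto_0[OF A(1), of "2 * R"]] R
    by (fastforce simp: eventually_sequentially)
  have "\<forall>\<^sub>F r in at_right R. \<forall>i\<in>{n<..<N}. absval (fps_nth A i) * r ^ i < absval (fps_nth A n) * r ^ n"
    using n by (intro eventually_ball_finite ballI eventually_scaled_less)
      (auto intro: not_dominant_index_less)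
  moreover have "\<forall>\<^sub>F r in at_right R. R < r \<and> r < 2 * R"
    using R eventually_at_right_real[of R "2 * R"] by simp
  ultimately show ?thesis
    unfolding n_def[symmetric] strictly_dominant_def
  proof eventually_elim
    case (elim r)
    show ?case
    proof (intro allI impI)
      fix i assume "i \<noteq> n"
      then consider "i < n" | "n < i" "i < N" | "i \<ge> N" by linarith
      then show "absval (fps_nth A i) * r ^ i < absval (fps_nth A n) * r ^ n"
      proof cases
        case 1
        have "(r / R) ^ i < (r / R) ^ n"
          using 1 elim R by (intro power_strict_increasing) auto
        then show ?thesis
          using n pos elim R by (intro scaled_dominant_less[of R]) (auto intro: dominant_indicesD)
      next
        case 3
        have "absval (fps_nth A i) * r ^ i \<le> absval (fps_nth A i) * (2 * R) ^ i"
          using elim R by (intro mult_left_mono power_mono) (auto simp: absval_nonneg)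
        also have "\<dots> < absval (fps_nth A n) * R ^ n"
          using 3 by (rule N)
        also have "\<dots> \<le> absval (fps_nth A n) * r ^ n"
          using elim R by (intro mult_left_mono power_mono) (auto simp: absval_nonneg)
        finally show ?thesis .
      qed (use elim in auto)
    qed
  qed
qed

text \<open>Term j outgrows each lower term i by a factor of order R^(j - i), and only finitely many
  indices lie below j.\<close>

lemma eventually_dominant_indices_ge:
  assumes "fps_nth (A :: 'a fps) j \<noteq> 0"
  shows "\<forall>\<^sub>F R in at_top. \<forall>i\<in>dominant_indices A R. i \<ge> j"
proof -
  have "\<forall>\<^sub>F R in at_top. absval (fps_nth A i) * R ^ i < absval (fps_nth A j) * R ^ j" if "i < j" for i
  proof -
    have "filterlim (\<lambda>R. absval (fps_nth A j) * R ^ (j - i)) at_top (at_top :: real filter)"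
      using assms that
      by (intro filterlim_tendsto_pos_mult_at_top[OF tendsto_const] filterlim_pow_at_top filterlim_ident) auto
    then have "\<forall>\<^sub>F R in at_top. absval (fps_nth A i) < absval (fps_nth A j) * R ^ (j - i)"
      by (simp add: filterlim_at_top_dense)
    then show ?thesis
      using eventually_gt_at_top[of 0]
    proof eventually_elim
      case (elim R)
      then have "absval (fps_nth A i) * R ^ i < absval (fps_nth A j) * R ^ (j - i) * R ^ i"
        by (intro mult_strict_right_mono) auto
      also have "\<dots> = absval (fps_nth A j) * R ^ j"
        using that by (simp add: mult.assoc flip: power_add)
      finally show ?case .
    qed
  qed
  then have "\<forall>\<^sub>F R in at_top. \<forall>i\<in>{..<j}. absval (fps_nth A i) * R ^ i < absval (fps_nth A j) * R ^ j"
    by (intro eventually_ball_finite) auto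
  then show ?thesis
  proof eventually_elim
    case (elim R)
    then show ?case
      using dominant_indicesD by (meson lessThan_iff not_le)
  qed
qed

text \<open>An m-th root x of p in \<open>L\<close> gives c = 1 / x with |c| = p^(1/m), close to 1
  for large m. The numbers |e| |c|^n then increase in steps too short to jump over the
  interval.\<close>

lemma absval_dense:
  fixes a b :: real
  assumes "a < b" "0 < b"
  obtains x :: 'a where "a < absval x" "absval x < b"
proof -
  \<comment> \<open>a may be negative or 0; u is the positive lower end of a subinterval.\<close>
  define u where "u = max a (b / 2)"
  have u: "0 < u" "u < b" "a \<le> u"
    using assms by (auto simp: u_def)
  have p1: "real p > 1"
    using prime_gt_1_nat[OF prime_p] by simp
  obtain m where m: "real p < (b / u) ^ m"
    using real_arch_pow[of "b / u"] u by auto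
  with p1 have m0: "m > 0"
    by (cases m) auto
  obtain L :: "'a set" where L: "is_subfield L"
    "\<And>P. poly_over L P \<Longrightarrow> degree P > 0 \<Longrightarrow> \<exists>x\<in>L. poly P x = 0"
    using ex_algebraically_closed_dense by metis
  have L01: "0 \<in> L" "1 \<in> L" "\<And>x y. x \<in> L \<Longrightarrow> y \<in> L \<Longrightarrow> x + y \<in> L" "\<And>x. x \<in> L \<Longrightarrow> - x \<in> L"
    using L(1) unfolding is_subfield_def by blast+
  have "of_nat k \<in> L" for k
    by (induction k) (auto simp: L01)
  then have over: "poly_over L (monom 1 m - [:of_nat p:])"
    unfolding poly_over_def using L01(4)[of "of_nat p"] m0 L01
    by (auto simp: coeff_pCons split: nat.split)
  have "coeff (monom 1 m - [:of_nat p :: 'a:]) m = 1"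
    using m0 by (simp add: coeff_pCons split: nat.split)
  then have "degree (monom 1 m - [:of_nat p :: 'a:]) \<ge> m"
    by (intro le_degree) simp
  then obtain x where "poly (monom 1 m - [:of_nat p :: 'a:]) x = 0"
    using L(2)[OF over] m0 by auto
  then have "x ^ m = of_nat p"
    by (simp add: poly_monom)
  then have xm: "absval x ^ m = 1 / real p"
    using absval_power[of x m] absval_p by simp
  define c where "c = inverse x"
  have cm: "absval c ^ m = real p"
    using xm by (simp add: c_def absval_inverse power_inverse)
  have c1: "absval c > 1"
  proof (rule ccontr)
    assume "\<not> ?thesis"
    then have "absval c ^ m \<le> 1 ^ m"
      by (intro power_mono) (auto simp: absval_nonneg)
    with cm p1 show False by simp
  qed
  have c2: "absval c < b / u"
    using m cm u power_less_imp_less_base[of "absval c" m "b / u"] by simp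
  obtain d :: 'a where d: "absval d > 1 / u"
    using ex_absval_gt by blast
  define e where "e = inverse d"
  have d0: "absval d > 0"
    using d u by (meson divide_pos_pos less_trans zero_less_one)
  have e: "0 < absval e" "absval e \<le> u"
    using d0 d u unfolding e_def absval_inverse by (auto simp: field_simps)
  obtain n0 where n0: "u / absval e < absval c ^ n0"
    using real_arch_pow[OF c1] by blast
  \<comment> \<open>The first power beyond u: its predecessor is at most u, and one step multiplies
    by less than b / u.\<close>
  define n where "n = (LEAST n. absval e * absval c ^ n > u)"
  have "absval e * absval c ^ n0 > u"
    using n0 e(1) by (metis mult.commute pos_divide_less_eq)
  then have n: "absval e * absval c ^ n > u"
    unfolding n_def by (rule LeastI)
  have "n \<noteq> 0"
    using n e by (intro notI) simp
  then have "\<not> absval e * absval c ^ (n - 1) > u"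
    unfolding n_def by (intro not_less_Least) simp
  then have "absval e * absval c ^ (n - 1) * absval c \<le> u * absval c"
    using c1 by (intro mult_right_mono) auto
  also have "\<dots> < b"
    using c2 u by (simp add: field_simps)
  finally have "absval e * absval c ^ n < b"
    using \<open>n \<noteq> 0\<close> by (cases n) (auto simp: mult_ac)
  then show ?thesis
    using that[of "e * c ^ n"] n u by (simp add: absval_mult absval_power)
qed

end

section \<open>Existence of zeros\<close>

lemma poly_over_pCons: "poly_over K (pCons a P) \<longleftrightarrow> a \<in> K \<and> poly_over K P"
  unfolding poly_over_def by (auto simp: coeff_pCons split: nat.splits)

lemma poly_over_poly_in:
  assumes "is_subfield K" "poly_over K P" "x \<in> K"
  shows "poly P x \<in> K"
  using assms(2)
proof (induction P)
  case 0
  then show ?case using assms(1) by (simp add: is_subfield_def)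
next
  case (pCons a P)
  then show ?case
    using assms(1,3) by (simp add: is_subfield_def poly_over_pCons)
qed

lemma poly_over_synthetic_div:
  assumes "is_subfield K" "poly_over K P" "x \<in> K"
  shows "poly_over K (synthetic_div P x)"
  using assms(2)
proof (induction P)
  case 0
  then show ?case by simp
next
  case (pCons a P)
  then show ?case
    using assms(1,3) by (simp add: poly_over_pCons poly_over_poly_in)
qed

text \<open>Roots are found inside \<open>K\<close>, so the quotient by X - x has coefficients in
  \<open>K\<close> again and the induction goes on.\<close>

lemma poly_over_split:
  fixes P :: "'a :: field poly"
  assumes K: "is_subfield K" "\<And>P. poly_over K P \<Longrightarrow> degree P > 0 \<Longrightarrow> \<exists>x\<in>K. poly P x = 0"
    and "poly_over K P"
  shows "\<exists>c rs. P = smult c (\<Prod>x\<leftarrow>rs. [:- x, 1:])"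
  using assms(3)
proof (induction "degree P" arbitrary: P)
  case 0
  then obtain c where "P = [:c:]"
    by (metis degree_eq_zeroE)
  then show ?case
    by (intro exI[of _ c] exI[of _ "[]"]) simp
next
  case (Suc n)
  then obtain x where x: "x \<in> K" "poly P x = 0"
    using K(2)[of P] by auto
  have P: "P = [:- x, 1:] * synthetic_div P x"
    using synthetic_div_correct'[of x P] x by simp
  obtain c rs where "synthetic_div P x = smult c (\<Prod>x\<leftarrow>rs. [:- x, 1:])"
    using Suc(1)[of "synthetic_div P x"] Suc(2)[symmetric] poly_over_synthetic_div[OF K(1) Suc(3) x(1)]
    by (auto simp: degree_synthetic_div)
  with P have "P = smult c (\<Prod>x\<leftarrow>x # rs. [:- x, 1:])"
    by (simp only: list.map prod_list.Cons mult_smult_right)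
  then show ?case by blast
qed

text \<open>The number of roots of a polynomial in a disc is its largest dominant index there.\<close>

lemma split_poly_gauss:
  fixes rs :: "'a :: nonarch_field list" and r :: real
  assumes r: "r > 0"
  defines "Q \<equiv> (\<Prod>x\<leftarrow>rs. [:- x, 1:])" and "ins \<equiv> filter (\<lambda>x. absval x \<le> r) rs"
  shows "\<exists>k>0. (\<forall>i. absval (coeff Q i) * r ^ i \<le> k * r ^ length ins) \<and>
    absval (coeff Q (length ins)) = k \<and>
    (\<forall>i>length ins. absval (coeff Q i) * r ^ i < k * r ^ length ins) \<and>
    (\<forall>x. absval x \<le> r \<longrightarrow> absval (poly Q x) = k * (\<Prod>a\<leftarrow>ins. absval (x - a)))"
  unfolding Q_def ins_def
proof (induction rs)
  case Nil
  show ?case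
    by (intro exI[of _ 1]) (auto simp: coeff_pCons split: nat.splits)
next
  case (Cons a rs)
  define Q where "Q = (\<Prod>x\<leftarrow>rs. [:- x, 1:])"
  define ins where "ins = filter (\<lambda>x. absval x \<le> r) rs"
  define m where "m = length ins"
  obtain k where k: "k > 0" "\<And>i. absval (coeff Q i) * r ^ i \<le> k * r ^ m"
    "absval (coeff Q m) = k" "\<And>i. i > m \<Longrightarrow> absval (coeff Q i) * r ^ i < k * r ^ m"
    "\<And>x. absval x \<le> r \<Longrightarrow> absval (poly Q x) = k * (\<Prod>a\<leftarrow>ins. absval (x - a))"
    using Cons.IH unfolding Q_def[symmetric] ins_def[symmetric] m_def[symmetric] by blast
  define Q' where "Q' = [:- a, 1:] * Q"
  have Q'_eq: "(\<Prod>x\<leftarrow>a # rs. [:- x, 1:]) = Q'"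
    by (simp add: Q_def Q'_def)
  have coeff_0: "coeff Q' 0 = - (a * coeff Q 0)"
    by (simp add: Q'_def)
  have coeff_Suc: "coeff Q' (Suc i) = coeff Q i - a * coeff Q (Suc i)" for i
    by (simp add: Q'_def)
  have poly_Q': "absval (poly Q' x) = absval (x - a) * absval (poly Q x)" for x
    by (simp add: Q'_def flip: absval_mult) (simp add: algebra_simps)
  have rm: "r ^ m > 0"
    using r by simp
  show ?case
  proof (cases "absval a \<le> r")
    \<comment> \<open>A root in the disc: X - a has largest dominant index 1, so the index moves up
      by one and k stays.\<close>
    case True
    have a1: "absval (a * coeff Q i) * r ^ i \<le> k * r ^ Suc m" for i
    proof -
      have "absval a * (absval (coeff Q i) * r ^ i) \<le> r * (k * r ^ m)"
        by (rule mult_mono) (use True k(2)[of i] r in \<open>auto simp: absval_nonneg\<close>)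
      then show ?thesis by (simp add: absval_mult mult_ac)
    qed
    have a2: "absval (a * coeff Q i) * r ^ i < k * r ^ Suc m" if "i > m" for i
    proof -
      have "absval a * (absval (coeff Q i) * r ^ i) \<le> r * (absval (coeff Q i) * r ^ i)"
        using True r by (intro mult_right_mono) (auto simp: absval_nonneg)
      also have "\<dots> < r * (k * r ^ m)"
        using k(4)[OF that] r by simp
      finally show ?thesis by (simp add: absval_mult mult_ac)
    qed
    have b1: "absval (coeff Q i) * r ^ Suc i \<le> k * r ^ Suc m" for i
      using mult_left_mono[OF k(2)[of i], of r] r by (simp add: mult_ac)
    have b2: "absval (coeff Q i) * r ^ Suc i < k * r ^ Suc m" if "i > m" for i
      using mult_strict_left_mono[OF k(4)[OF that], of r] r by (simp add: mult_ac)
    have 1: "absval (coeff Q' i) * r ^ i \<le> k * r ^ Suc m" for i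
    proof (cases i)
      case 0
      then show ?thesis using a1[of 0] by (simp add: coeff_0)
    next
      case (Suc j)
      have "absval (coeff Q j - a * coeff Q (Suc j)) \<le> k * r ^ Suc m / r ^ Suc j"
        using a1[of "Suc j"] b1[of j] r by (intro absval_diff_le) (simp_all add: field_simps)
      then show ?thesis
        using r unfolding Suc coeff_Suc by (simp add: field_simps)
    qed
    have 2: "absval (coeff Q' (Suc m)) = k"
    proof -
      have "absval (a * coeff Q (Suc m)) < absval (coeff Q m)"
        using a2[of "Suc m"] r by (simp add: k(3))
      then show ?thesis
        by (simp add: coeff_Suc absval_diff_eq k(3))
    qed
    have 3: "absval (coeff Q' i) * r ^ i < k * r ^ Suc m" if "i > Suc m" for i
    proof (cases i)
      case (Suc j)
      have "absval (coeff Q j - a * coeff Q (Suc j)) < k * r ^ Suc m / r ^ Suc j"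
        using a2[of "Suc j"] b2[of j] that Suc r by (intro absval_diff_less) (simp_all add: field_simps)
      then show ?thesis
        using r unfolding Suc coeff_Suc by (simp add: field_simps)
    qed (use that in simp)
    have 4: "absval (poly Q' x) = k * (\<Prod>a\<leftarrow>a # ins. absval (x - a))" if "absval x \<le> r" for x
      using k(5)[OF that] by (simp add: poly_Q')
    have "filter (\<lambda>x. absval x \<le> r) (a # rs) = a # ins" "length (a # ins) = Suc m"
      using True by (simp_all add: ins_def m_def)
    then show ?thesis
      unfolding Q'_eq using k(1) 1 2 3 4 by metis
  next
    \<comment> \<open>A root outside the disc: the constant term dominates X - a, so the index stays
      and k is multiplied by |a|.\<close>
    case False
    then have a: "absval a > r" "absval a > 0"
      using r by linarith+
    have b: "absval (coeff Q i) * r ^ Suc i < (k * absval a) * r ^ m" for i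
    proof -
      have "r * (absval (coeff Q i) * r ^ i) \<le> r * (k * r ^ m)"
        using k(2)[of i] r by simp
      also have "\<dots> < absval a * (k * r ^ m)"
        using a k(1) rm by (intro mult_strict_right_mono) auto
      finally show ?thesis by (simp add: mult_ac)
    qed
    have a1: "absval (a * coeff Q i) * r ^ i \<le> (k * absval a) * r ^ m" for i
      using mult_left_mono[OF k(2)[of i], of "absval a"] a by (simp add: absval_mult mult_ac)
    have a2: "absval (a * coeff Q i) * r ^ i < (k * absval a) * r ^ m" if "i > m" for i
      using mult_strict_left_mono[OF k(4)[OF that], of "absval a"] a by (simp add: absval_mult mult_ac)
    have 1: "absval (coeff Q' i) * r ^ i \<le> (k * absval a) * r ^ m" for i
    proof (cases i)
      case 0
      then show ?thesis using a1[of 0] by (simp add: coeff_0)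
    next
      case (Suc j)
      have "absval (coeff Q j - a * coeff Q (Suc j)) \<le> (k * absval a) * r ^ m / r ^ Suc j"
        using a1[of "Suc j"] b[of j] r by (intro absval_diff_le) (simp_all add: field_simps)
      then show ?thesis
        using r unfolding Suc coeff_Suc by (simp add: field_simps)
    qed
    have 2: "absval (coeff Q' m) = k * absval a"
    proof (cases m)
      case 0
      then show ?thesis using k(3) by (simp add: coeff_0 absval_mult)
    next
      case (Suc j)
      have "absval (coeff Q j) * r ^ m < absval (a * coeff Q m) * r ^ m"
        using b[of j] unfolding Suc[symmetric] by (simp add: absval_mult k(3) mult_ac)
      then have "absval (coeff Q j) < absval (- (a * coeff Q m))"
        using rm by simp
      then have "absval (- (a * coeff Q m) + coeff Q j) = absval (- (a * coeff Q m))"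
        by (rule absval_add_eq)
      then show ?thesis
        unfolding Suc coeff_Suc using k(3) Suc by (simp add: absval_mult)
    qed
    have 3: "absval (coeff Q' i) * r ^ i < (k * absval a) * r ^ m" if "i > m" for i
    proof (cases i)
      case (Suc j)
      have "absval (coeff Q j - a * coeff Q (Suc j)) < (k * absval a) * r ^ m / r ^ Suc j"
        using a2[of "Suc j"] b[of j] that Suc r by (intro absval_diff_less) (simp_all add: field_simps)
      then show ?thesis
        using r unfolding Suc coeff_Suc by (simp add: field_simps)
    qed (use that in simp)
    have 4: "absval (poly Q' x) = (k * absval a) * (\<Prod>a\<leftarrow>ins. absval (x - a))" if "absval x \<le> r" for x
    proof -
      have "absval (x - a) = absval a"
        using absval_diff_eq[of x a] that a by (simp add: absval_minus_commute)
      then show ?thesis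
        using k(5)[OF that] by (simp add: poly_Q')
    qed
    have "filter (\<lambda>x. absval x \<le> r) (a # rs) = ins" "length ins = m" "k * absval a > 0"
      using False a k(1) by (simp_all add: ins_def m_def)
    then show ?thesis
      unfolding Q'_eq using 1 2 3 4 by metis
  qed
qed

lemma prod_list_greater_power:
  fixes f :: "'b \<Rightarrow> real"
  assumes "\<And>x. x \<in> set xs \<Longrightarrow> f x > d" "d \<ge> 0" "xs \<noteq> []"
  shows "(\<Prod>x\<leftarrow>xs. f x) > d ^ length xs"
  using assms(3,1)
proof (induction xs rule: list_nonempty_induct)
  case (cons x xs)
  have "d * d ^ length xs < f x * prod_list (map f xs)"
    using cons assms(2) by (intro mult_strict_mono') auto
  then show ?case by simp
qed simp

context padic_complex_field
begin

text \<open>A truncation of \<open>A\<close> is not known to split, but its coefficients can be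
  moved slightly into the dense subfield \<open>L\<close>, over which every polynomial
  splits.\<close>

lemma entire_split_poly_approx:
  assumes A: "entire (A :: 'a fps)" and r: "r > 0" and e: "e > 0"
  obtains c :: 'a and rs where
    "gauss_bound (A - fps_of_poly (smult c (\<Prod>x\<leftarrow>rs. [:- x, 1:]))) r e"
proof -
  obtain L :: "'a set" where L: "is_subfield L" "closure L = UNIV"
    "\<And>P. poly_over L P \<Longrightarrow> degree P > 0 \<Longrightarrow> \<exists>x\<in>L. poly P x = 0"
    using ex_algebraically_closed_dense by metis
  obtain P where P: "gauss_bound (A - fps_of_poly P) r e"
    using entire_poly_approx[OF A _ e, of r] r by auto
  have "\<exists>l\<in>L. absval (coeff P i - l) * r ^ i < e" for i
  proof -
    have "e / r ^ i > 0"
      using e r by simp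
    then obtain l where "l \<in> L" "dist l (coeff P i) < e / r ^ i"
      using L(2) closure_approachable[of "coeff P i" L] by blast
    then show ?thesis
      using r by (intro bexI[of _ l]) (auto simp: dist_absval absval_minus_commute field_simps)
  qed
  then obtain l where l: "\<And>i. l i \<in> L" "\<And>i. absval (coeff P i - l i) * r ^ i < e"
    by metis
  define Q where "Q = Poly (map l [0..<Suc (degree P)])"
  have coeff_Q: "coeff Q i = (if i \<le> degree P then l i else 0)" for i
    by (auto simp: Q_def nth_default_def simp del: upt_Suc)
  have "poly_over L Q"
    using l(1) L(1) by (auto simp: poly_over_def coeff_Q is_subfield_def)
  then obtain c rs where Q: "Q = smult c (\<Prod>x\<leftarrow>rs. [:- x, 1:])"
    using poly_over_split[OF L(1,3)] by blast
  have "gauss_bound (fps_of_poly (P - Q)) r e"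
    unfolding gauss_bound_def
    using l(2) e by (auto simp: coeff_Q coeff_eq_0 less_imp_le)
  then have "gauss_bound (A - fps_of_poly P + fps_of_poly (P - Q)) r e"
    using P r by (intro gauss_bound_add) auto
  then show ?thesis
    using that[of c rs] unfolding Q[symmetric] by (simp add: fps_of_poly_diff)
qed

text \<open>
  Near a point where \<open>A\<close> is small there is one where it is even smaller, namely a root of a
  polynomial close to \<open>A\<close>. The number \<open>N\<close> of roots in the disc, hence the rate, is the same
  for all such polynomials.
\<close>

lemma entire_improve_zero:
  assumes A: "entire (A :: 'a fps)" and r: "r > 0" and W: "W > 0" "N > 0"
    and AN: "absval (fps_nth A N) * r ^ N = W" "gauss_bound A r W"
      "\<And>i. i > N \<Longrightarrow> absval (fps_nth A i) * r ^ i < W"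
    and e: "0 < e" "e < W" "e \<le> W * d ^ N" and d: "d \<ge> 0"
    and x: "absval x \<le> r" "absval (entire_eval A x) \<le> W * d ^ N"
  obtains y where "absval y \<le> r" "absval (y - x) \<le> r * d" "absval (entire_eval A y) \<le> e"
proof -
  obtain c rs where P: "gauss_bound (A - fps_of_poly (smult c (\<Prod>x\<leftarrow>rs. [:- x, 1:]))) r e"
    using entire_split_poly_approx[OF A r e(1)] .
  define Q where "Q = (\<Prod>x\<leftarrow>rs. [:- x, 1:])"
  define ins where "ins = filter (\<lambda>x. absval x \<le> r) rs"
  define m where "m = length ins"
  obtain k where k: "k > 0" "\<And>i. absval (coeff Q i) * r ^ i \<le> k * r ^ m"
    "absval (coeff Q m) = k" "\<And>i. i > m \<Longrightarrow> absval (coeff Q i) * r ^ i < k * r ^ m"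
    "\<And>x. absval x \<le> r \<Longrightarrow> absval (poly Q x) = k * (\<Prod>a\<leftarrow>ins. absval (x - a))"
    using split_poly_gauss[OF r, of rs] unfolding Q_def[symmetric] ins_def[symmetric] m_def[symmetric] by blast
  have diff: "absval (fps_nth A i - c * coeff Q i) * r ^ i \<le> e" for i
    using gauss_boundD[OF P, of i] by (simp add: Q_def)
  \<comment> \<open>As e < W, the perturbation is too small to change the size of coefficient
    \<open>N\<close>.\<close>
  have PN: "absval (c * coeff Q N) * r ^ N = W"
  proof -
    have "absval (fps_nth A N - c * coeff Q N) * r ^ N < absval (fps_nth A N) * r ^ N"
      using diff[of N] e AN(1) by linarith
    then have "absval (fps_nth A N - (fps_nth A N - c * coeff Q N)) = absval (fps_nth A N)"
      using r by (intro absval_diff_eq) simp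
    then show ?thesis
      using AN(1) by simp
  qed
  have Pi: "absval (c * coeff Q i) * r ^ i \<le> W" for i
  proof -
    have "absval (fps_nth A i - (fps_nth A i - c * coeff Q i)) \<le> W / r ^ i"
      by (rule absval_diff_le)
        (use gauss_boundD[OF AN(2), of i] diff[of i] e r in \<open>auto simp: field_simps\<close>)
    then show ?thesis
      using r by (simp add: field_simps)
  qed
  have Pi': "absval (c * coeff Q i) * r ^ i < W" if "i > N" for i
  proof -
    have "absval (fps_nth A i - (fps_nth A i - c * coeff Q i)) < W / r ^ i"
      by (rule absval_diff_less) (use AN(3)[OF that] diff[of i] e r in \<open>auto simp: field_simps\<close>)
    then show ?thesis
      using r by (simp add: field_simps)
  qed
  have c: "absval c > 0"
    using PN W by (cases "c = 0") auto
  have max: "absval c * k * r ^ m = W"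
  proof (rule antisym)
    show "absval c * k * r ^ m \<le> W"
      using Pi[of m] by (simp add: absval_mult k(3))
    show "W \<le> absval c * k * r ^ m"
      using PN mult_left_mono[OF k(2)[of N], of "absval c"] c by (simp add: absval_mult mult_ac)
  qed
  \<comment> \<open>Both are the largest dominant index at r of the split polynomial: N is inherited
    from \<open>A\<close>, and m counts the roots in the disc.\<close>
  have "m = N"
  proof (rule ccontr)
    assume "m \<noteq> N"
    then consider "m < N" | "N < m" by linarith
    then show False
    proof cases
      case 1
      have "absval c * (absval (coeff Q N) * r ^ N) < absval c * (k * r ^ m)"
        using k(4)[OF 1] c by (intro mult_strict_left_mono) auto
      then show False
        using PN max by (simp add: absval_mult mult_ac)
    next
      case 2
      then show False
        using Pi'[of m] max by (simp add: absval_mult k(3))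
    qed
  qed
  have approx: "absval (entire_eval A y - c * poly Q y) \<le> e" if "absval y \<le> r" for y
  proof -
    have "absval (entire_eval (A - fps_of_poly (smult c Q)) y) \<le> e"
      using A that P unfolding Q_def
      by (intro absval_entire_eval_le entire_diff entire_of_poly gauss_bound_mono[OF P])
        (auto simp: absval_nonneg)
    then show ?thesis
      using A by (simp add: entire_eval_diff entire_of_poly entire_eval_of_poly)
  qed
  \<comment> \<open>If all N roots in the disc were farther than r d from x, the product formula
    would make the polynomial exceed W d^N at x, against the smallness of \<open>A\<close>
    there.\<close>
  have "\<exists>a\<in>set ins. absval (x - a) \<le> r * d"
  proof (rule ccontr)
    assume "\<not> ?thesis"
    moreover have "ins \<noteq> []"
      using \<open>m = N\<close> W by (auto simp: m_def)
    ultimately have "(\<Prod>a\<leftarrow>ins. absval (x - a)) > (r * d) ^ m"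
      using r d unfolding m_def by (intro prod_list_greater_power) auto
    then have "absval c * k * (r * d) ^ m < absval c * k * (\<Prod>a\<leftarrow>ins. absval (x - a))"
      using c k(1) by simp
    moreover have "absval c * k * (r * d) ^ m = W * d ^ N"
      using max \<open>m = N\<close> by (simp add: power_mult_distrib mult_ac)
    ultimately have "absval (c * poly Q x) > W * d ^ N"
      using k(5)[OF x(1)] by (simp add: absval_mult mult_ac)
    moreover have "absval (entire_eval A x - (entire_eval A x - c * poly Q x)) \<le> W * d ^ N"
      by (rule absval_diff_le) (use x(2) approx[OF x(1)] e(3) in auto)
    ultimately show False by simp
  qed
  then obtain a where a: "a \<in> set ins" "absval (x - a) \<le> r * d"
    by blast
  have ar: "absval a \<le> r" "a \<in> set rs"
    using a(1) by (auto simp: ins_def)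
  have "poly Q a = 0"
    using ar(2) unfolding Q_def by (induction rs) auto
  then show ?thesis
    using that[of a] ar a approx[of a] by (simp add: absval_minus_commute)
qed

text \<open>Starting at 0, step n moves by at most r / 2^n to a point where |A| is at most W / 2^((n
  + 1) N). These points form a Cauchy sequence, and by continuity A vanishes at its limit.\<close>

theorem entire_ex_zero:
  assumes A: "entire (A :: 'a fps)" "A \<noteq> 0" and r: "r > 0" and "\<not> strictly_dominant A r 0"
  obtains x where "absval x \<le> r" "entire_eval A x = 0"
proof -
  define N where "N = Max (dominant_indices A r)"
  define W where "W = absval (fps_nth A N) * r ^ N"
  note dom = dominant_indices_finite_nonempty[OF A r]
  have N: "N \<in> dominant_indices A r" "\<And>i. i > N \<Longrightarrow> i \<notin> dominant_indices A r"
    using dom Max_in[of "dominant_indices A r"] Max_ge[of "dominant_indices A r"]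
    by (auto simp: N_def leD)
  have W: "W > 0"
    using dominant_indices_nth_neq_0[OF A(2) r N(1)] r by (simp add: W_def)
  \<comment> \<open>This is where the failure of strict dominance of index 0 enters; for N = 0 the
    bounds W d^N would not shrink.\<close>
  have N0: "N > 0"
  proof (rule ccontr)
    assume "\<not> N > 0"
    obtain i where i: "i \<noteq> 0" "absval (fps_nth A i) * r ^ i \<ge> absval (fps_nth A 0) * r ^ 0"
      using assms(4) by (auto simp: strictly_dominant_def not_less)
    have "0 \<in> dominant_indices A r"
      using N(1) \<open>\<not> N > 0\<close> by simp
    then have "i \<in> dominant_indices A r"
      using not_dominant_index_less i(2) not_le by blast
    with N(2)[of i] i(1) \<open>\<not> N > 0\<close> show False by simp
  qed
  have AN: "absval (fps_nth A N) * r ^ N = W" "gauss_bound A r W"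
    "\<And>i. i > N \<Longrightarrow> absval (fps_nth A i) * r ^ i < W"
    using N not_dominant_index_less[OF N(1)] dominant_indicesD[OF N(1)]
    by (simp_all add: W_def gauss_bound_def)
  have "\<exists>X. \<forall>n. (absval (X n) \<le> r \<and> absval (entire_eval A (X n)) \<le> W * ((1/2) ^ n) ^ N) \<and>
    absval (X (Suc n) - X n) \<le> r * (1/2) ^ n"
  proof (rule dependent_nat_choice)
    show "\<exists>x. absval x \<le> r \<and> absval (entire_eval A x) \<le> W * ((1/2) ^ 0) ^ N"
      using gauss_boundD[OF AN(2), of 0] r by (intro exI[of _ 0]) (simp add: entire_eval_at_0)
  next
    fix x n
    assume x: "absval x \<le> r \<and> absval (entire_eval A x) \<le> W * ((1/2) ^ n) ^ N"
    have "((1/2::real) ^ Suc n) ^ N < 1"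
      using N0 by (simp flip: power_mult power_Suc add: power_less_one_iff)
    moreover have "((1/2::real) ^ Suc n) ^ N \<le> ((1/2) ^ n) ^ N"
      by (intro power_mono power_decreasing) auto
    ultimately have "W * ((1/2) ^ Suc n) ^ N < W" "W * ((1/2) ^ Suc n) ^ N \<le> W * ((1/2) ^ n) ^ N"
      using W by (simp_all del: power_Suc)
    moreover have "0 < W * ((1/2) ^ Suc n) ^ N"
      using W by simp
    ultimately obtain y where "absval y \<le> r" "absval (y - x) \<le> r * (1/2) ^ n"
      "absval (entire_eval A y) \<le> W * ((1/2) ^ Suc n) ^ N"
      using entire_improve_zero[OF A(1) r W N0 AN, of "W * ((1/2) ^ Suc n) ^ N" "(1/2) ^ n" x] x
      by (metis half_gt_zero_iff less_eq_real_def zero_le_power zero_less_one)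
    then show "\<exists>y. (absval y \<le> r \<and> absval (entire_eval A y) \<le> W * ((1/2) ^ Suc n) ^ N) \<and>
        absval (y - x) \<le> r * (1/2) ^ n"
      by blast
  qed
  then obtain X where X: "\<And>n. absval (X n) \<le> r" "\<And>n. absval (entire_eval A (X n)) \<le> W * ((1/2) ^ n) ^ N"
    "\<And>n. absval (X (Suc n) - X n) \<le> r * (1/2) ^ n"
    by auto
  have half: "(\<lambda>n. (1/2 :: real) ^ n) \<longlonglongrightarrow> 0"
    by (intro LIMSEQ_realpow_zero) auto
  have "(\<lambda>n. absval (X (Suc n) - X n - 0)) \<longlonglongrightarrow> 0"
    by (rule Lim_null_comparison[OF always_eventually tendsto_mult_right_zero[OF half, of r]])
      (use X(3) in \<open>simp add: absval_nonneg\<close>)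
  then have "convergent X"
    unfolding tendsto_absval_iff[symmetric] by (rule Cauchy_nonarch_convergent)
  then obtain x where x: "X \<longlonglongrightarrow> x"
    unfolding convergent_def ..
  have "absval x \<le> r"
    using tendsto_absval[OF x] X(1) by (intro LIMSEQ_le_const2) auto
  moreover have "absval (entire_eval A x) \<le> 0"
  proof (rule LIMSEQ_le)
    show "(\<lambda>n. absval (entire_eval A (X n))) \<longlonglongrightarrow> absval (entire_eval A x)"
      by (intro tendsto_absval tendsto_entire_eval A x)
    show "(\<lambda>n. W * ((1/2) ^ n) ^ N) \<longlonglongrightarrow> 0"
      using tendsto_mult_right_zero[OF tendsto_null_power[OF half N0], of W] by simp
  qed (use X(2) in blast)
  then have "entire_eval A x = 0"
    using absval_nonneg[of "entire_eval A x"] absval_eq_0_iff[of "entire_eval A x"] by simp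
  ultimately show ?thesis
    using that by blast
qed

end

section \<open>Meromorphic functions\<close>

context padic_complex_field
begin

text \<open>For |c| <= r, the index after the largest dominant one of B becomes dominant in the
  product. So the largest dominant index falls with every zero removed from the disc and serves as
  the measure of the later inductions.\<close>

lemma Max_dominant_indices_linear_mult:
  assumes B: "entire (B :: 'a fps)" "B \<noteq> 0" and c: "absval c \<le> r" "r > 0"
  shows "Max (dominant_indices B r) < Max (dominant_indices ((fps_X - fps_const c) * B) r)"
proof -
  define n where "n = Max (dominant_indices B r)"
  define A where "A = (fps_X - fps_const c) * B"
  have A: "entire A" "A \<noteq> 0"
    using B by (auto simp: A_def entire_mult)
  note dom = dominant_indices_finite_nonempty[OF B c(2)]
  have n: "n \<in> dominant_indices B r" "\<And>i. i > n \<Longrightarrow> i \<notin> dominant_indices B r"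
    using dom Max_in[of "dominant_indices B r"] Max_ge[of "dominant_indices B r"]
    by (auto simp: n_def leD)
  have coeffs: "fps_nth A 0 = - (c * fps_nth B 0)"
    "fps_nth A (Suc i) = fps_nth B i - c * fps_nth B (Suc i)" for i
    by (simp_all add: A_def algebra_simps)
  define W where "W = absval (fps_nth B n) * r ^ Suc n"
  have cB: "absval (c * fps_nth B i) * r ^ i \<le> r * (absval (fps_nth B i) * r ^ i)" for i
    using mult_right_mono[OF c(1), of "absval (fps_nth B i) * r ^ i"] c(2)
    by (simp add: absval_mult absval_nonneg mult_ac)
  have le: "r * (absval (fps_nth B i) * r ^ i) \<le> W" for i
    using mult_left_mono[OF dominant_indicesD[OF n(1), of i], of r] c(2)
    by (simp add: W_def mult_ac)
  have less: "r * (absval (fps_nth B (Suc n)) * r ^ Suc n) < W"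
    using mult_strict_left_mono[OF not_dominant_index_less[OF n(1) n(2)[of "Suc n"]] c(2)]
    by (simp add: W_def mult_ac)
  have AW: "absval (fps_nth A i) * r ^ i \<le> W" for i
  proof (cases i)
    case 0
    then show ?thesis
      using order_trans[OF cB[of 0] le[of 0]] by (simp add: coeffs)
  next
    case (Suc j)
    have "absval (fps_nth B j - c * fps_nth B (Suc j)) \<le> W / r ^ Suc j"
      by (rule absval_diff_le)
        (use order_trans[OF cB[of "Suc j"] le[of "Suc j"]] le[of j] c(2) in \<open>simp_all add: field_simps\<close>)
    then show ?thesis
      using c(2) by (simp add: Suc coeffs field_simps)
  qed
  have "absval (c * fps_nth B (Suc n)) < absval (fps_nth B n)"
  proof -
    have "absval (c * fps_nth B (Suc n)) * r ^ Suc n < absval (fps_nth B n) * r ^ Suc n"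
      using cB[of "Suc n"] less unfolding W_def by linarith
    then show ?thesis
      using c(2) by (simp add: mult_less_cancel_right)
  qed
  then have "absval (fps_nth A (Suc n)) * r ^ Suc n = W"
    by (simp only: coeffs absval_diff_eq W_def)
  then have "Suc n \<in> dominant_indices A r"
    using AW by (simp add: dominant_indices_def)
  then have "Suc n \<le> Max (dominant_indices A r)"
    using dominant_indices_finite_nonempty[OF A c(2)] by (intro Max_ge)
  then show ?thesis
    by (simp add: n_def A_def)
qed

lemma entire_factor_order:
  assumes "entire (A :: 'a fps)" "A \<noteq> 0"
  obtains k B where "entire B" "A = (fps_X - fps_const c) ^ k * B" "entire_eval B c \<noteq> 0"
proof -
  define r where "r = absval c + 1"
  have r: "absval c \<le> r" "r > 0"
    using absval_nonneg[of c] by (auto simp: r_def)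
  have "\<exists>k B. entire B \<and> A = (fps_X - fps_const c) ^ k * B \<and> entire_eval B c \<noteq> 0"
    using assms
  proof (induction "Max (dominant_indices A r)" arbitrary: A rule: less_induct)
    case less
    show ?case
    proof (cases "entire_eval A c = 0")
      case True
      then obtain A1 where A1: "entire A1" "A = (fps_X - fps_const c) * A1"
        using entire_zero_factor less.prems by blast
      then have "A1 \<noteq> 0"
        using less.prems by auto
      then obtain k B where "entire B" "A1 = (fps_X - fps_const c) ^ k * B" "entire_eval B c \<noteq> 0"
        using less.hyps[of A1] Max_dominant_indices_linear_mult[OF A1(1) _ r] A1 by auto
      then show ?thesis
        using A1(2) by (intro exI[of _ "Suc k"] exI[of _ B]) (simp add: mult_ac)
    qed (use less.prems in \<open>auto intro!: exI[of _ 0] exI[of _ A]\<close>)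
  qed
  then show ?thesis
    using that by blast
qed

text \<open>Nonzero elements of arbitrarily small absolute value exist, so no point is isolated;
  this makes limits at a point unique.\<close>

lemma at_neq_bot: "at (c :: 'a) \<noteq> bot"
proof -
  have "\<exists>x. x \<noteq> c \<and> dist x c < e" if e: "e > 0" for e
  proof -
    obtain z :: 'a where "0 < absval z" "absval z < e"
      by (rule absval_dense[of 0 e, OF e e])
    then show ?thesis
      by (intro exI[of _ "c + z"]) (simp add: dist_absval)
  qed
  then show ?thesis
    unfolding trivial_limit_def[symmetric] trivial_limit_within islimpt_approachable by blast
qed

lemma eventually_entire_neq_0:
  assumes "entire (A :: 'a fps)" "A \<noteq> 0"
  shows "\<forall>\<^sub>F x in at c. entire_eval A x \<noteq> 0"
proof -
  obtain k B where B: "entire B" "A = (fps_X - fps_const c) ^ k * B" "entire_eval B c \<noteq> 0"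
    using entire_factor_order[OF assms] .
  have "((\<lambda>x. entire_eval B x) \<longlongrightarrow> entire_eval B c) (at c)"
    by (intro tendsto_entire_eval B tendsto_ident_at)
  then have "\<forall>\<^sub>F x in at c. entire_eval B x \<noteq> 0"
    using B(3) by (rule tendsto_imp_eventually_ne)
  moreover have "\<forall>\<^sub>F x in at c. x \<noteq> c"
    by (simp add: eventually_at_filter)
  ultimately show ?thesis
  proof eventually_elim
    case (elim x)
    then show ?case
      using B by (simp add: entire_eval_mult entire_eval_power entire_power)
  qed
qed

lemma entire_surj:
  assumes A: "entire (A :: 'a fps)" and n: "n > 0" "fps_nth A n \<noteq> 0"
  obtains x where "entire_eval A x = w"
proof -
  define B where "B = A - fps_const w"
  have B: "entire B" "fps_nth B n \<noteq> 0"
    using A n by (simp_all add: B_def entire_diff)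
  obtain r where r: "r > 1" "absval (fps_nth B n) * r > absval (fps_nth B 0)"
  proof
    \<comment> \<open>Chosen so that |b_n| r, and hence |b_n| r^n, exceeds the constant term, which
      refutes strict dominance of index 0. The summand 2 gives r > 1, used for r <= r^n.\<close>
    let ?r = "absval (fps_nth B 0) / absval (fps_nth B n) + 2"
    have "absval (fps_nth B 0) / absval (fps_nth B n) \<ge> 0"
      by (simp add: absval_nonneg)
    then show "?r > 1" by simp
    show "absval (fps_nth B n) * ?r > absval (fps_nth B 0)"
      using B(2) by (simp add: field_simps absval_eq_0_iff)
  qed
  have "absval (fps_nth B n) * r \<le> absval (fps_nth B n) * r ^ n"
    using r n by (intro mult_left_mono self_le_power) (auto simp: absval_nonneg)
  with r n have "\<not> strictly_dominant B r 0"
    by (auto simp: strictly_dominant_def intro!: exI[of _ n])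
  moreover have "B \<noteq> 0"
    using B(2) by auto
  ultimately obtain x where "entire_eval B x = 0"
    using entire_ex_zero[OF B(1)] r by (metis less_trans zero_less_one)
  then show ?thesis
    using that A by (simp add: B_def entire_eval_diff)
qed

text \<open>Solving for the coefficients of Q recursively costs only a division by U_0: as U_0
  strictly dominates, the other terms of the convolution stay within the bound by induction.\<close>

lemma gauss_bound_quotient:
  assumes U: "strictly_dominant (U :: 'a fps) r 0" and V: "gauss_bound (U * Q) r M" and r: "r > 0"
  shows "gauss_bound Q r (M / absval (fps_nth U 0))"
proof -
  define u where "u = absval (fps_nth U 0)"
  have Ui: "absval (fps_nth U i) * r ^ i < u" if "i \<noteq> 0" for i
    using U that by (simp add: strictly_dominant_def u_def)
  have u: "u > 0"
    using le_less_trans[OF _ Ui[of 1]] r by (simp add: absval_nonneg)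
  have "absval (fps_nth Q n) * r ^ n \<le> M / u" for n
  proof (induction n rule: less_induct)
    case (less n)
    have rn: "r ^ n > 0"
      using r by simp
    have "fps_nth (U * Q) n = fps_nth U 0 * fps_nth Q n + (\<Sum>i=1..n. fps_nth U i * fps_nth Q (n - i))"
      by (simp add: fps_mult_nth sum.atLeast_Suc_atMost)
    then have eq: "fps_nth U 0 * fps_nth Q n = fps_nth (U * Q) n - (\<Sum>i=1..n. fps_nth U i * fps_nth Q (n - i))"
      by simp
    have "absval (fps_nth (U * Q) n) \<le> M / r ^ n"
      using gauss_boundD[OF V, of n] rn by (simp add: field_simps)
    moreover have "absval (\<Sum>i=1..n. fps_nth U i * fps_nth Q (n - i)) \<le> M / r ^ n"
    proof (rule absval_sum_le)
      fix i assume i: "i \<in> {1..n}"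
      have "absval (fps_nth U i * fps_nth Q (n - i)) * r ^ n
          = (absval (fps_nth U i) * r ^ i) * (absval (fps_nth Q (n - i)) * r ^ (n - i))"
        using i by (simp add: absval_mult mult_ac flip: power_add)
      also have "\<dots> \<le> u * (M / u)"
        using i Ui[of i] less[of "n - i"] u r by (intro mult_mono) (auto simp: absval_nonneg)
      finally show "absval (fps_nth U i * fps_nth Q (n - i)) \<le> M / r ^ n"
        using rn u by (simp add: field_simps)
    qed (use gauss_bound_nonneg[OF V] rn in simp)
    ultimately have "absval (fps_nth U 0 * fps_nth Q n) \<le> M / r ^ n"
      unfolding eq by (rule absval_diff_le)
    then show ?case
      using rn u by (simp add: absval_mult field_simps flip: u_def)
  qed
  then show ?thesis
    by (simp add: gauss_bound_def u_def)
qed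

text \<open>The quotient B / A has no pole at x. Cross-multiplied, the condition stays within power
  series and survives the cancellation of common factors.\<close>

definition regular_at :: "'a fps \<Rightarrow> 'a fps \<Rightarrow> 'a \<Rightarrow> bool" where
  "regular_at B A x \<longleftrightarrow> (\<exists>A' B'. entire A' \<and> entire B' \<and> entire_eval A' x \<noteq> 0 \<and> B * A' = A * B')"

text \<open>A zero c of \<open>A\<close> in the disc is, by regularity, one of \<open>B\<close>, and
  X - c cancels from both. The process ends once index 0 is strictly dominant in the denominator,
  the only case in which \<open>entire_ex_zero\<close> supplies no further zero.\<close>

lemma cancel_zeros_in_disc:
  assumes "entire A" "entire B" "A \<noteq> 0" and "r > 0"
    and "\<And>x. absval x \<le> r \<Longrightarrow> regular_at B A x"
  shows "\<exists>U V. entire U \<and> entire V \<and> strictly_dominant U r 0 \<and> B * U = A * V"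
  using assms
proof (induction "Max (dominant_indices A r)" arbitrary: A B rule: less_induct)
  case less
  show ?case
  proof (cases "strictly_dominant A r 0")
    case False
    then obtain c where c: "absval c \<le> r" "entire_eval A c = 0"
      using entire_ex_zero less.prems by metis
    obtain A' B' where *: "entire A'" "entire B'" "entire_eval A' c \<noteq> 0" "B * A' = A * B'"
      using less.prems(5)[OF c(1)] unfolding regular_at_def by blast
    have "entire_eval B c * entire_eval A' c = entire_eval A c * entire_eval B' c"
      using * less.prems by (simp flip: entire_eval_mult)
    then have "entire_eval B c = 0"
      using *(3) c(2) by simp
    then obtain B1 where B1: "entire B1" "B = (fps_X - fps_const c) * B1"
      using entire_zero_factor less.prems by blast
    obtain A1 where A1: "entire A1" "A = (fps_X - fps_const c) * A1"
      using entire_zero_factor less.prems c by blast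
    have "A1 \<noteq> 0"
      using less.prems A1 by auto
    have "regular_at B1 A1 x" if x: "absval x \<le> r" for x
    proof -
      obtain A' B' where *: "entire A'" "entire B'" "entire_eval A' x \<noteq> 0" "B * A' = A * B'"
        using less.prems(5)[OF x] unfolding regular_at_def by blast
      have "(fps_X - fps_const c) * (B1 * A') = (fps_X - fps_const c) * (A1 * B')"
        using *(4) A1 B1 by (simp add: mult.assoc)
      then have "B1 * A' = A1 * B'"
        by (simp only: mult_cancel_left linear_fps_neq_0) simp
      with * show ?thesis
        unfolding regular_at_def by blast
    qed
    then obtain U V where UV: "entire U" "entire V" "strictly_dominant U r 0" "B1 * U = A1 * V"
      using less.hyps[of A1 B1] Max_dominant_indices_linear_mult[OF A1(1) \<open>A1 \<noteq> 0\<close> c(1) \<open>r > 0\<close>]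
        A1 B1 \<open>A1 \<noteq> 0\<close> \<open>r > 0\<close> by auto
    then have "B * U = A * V"
      by (simp add: A1 B1 mult.assoc)
    with UV show ?thesis by blast
  qed (use less.prems in \<open>auto simp: mult.commute\<close>)
qed

text \<open>The quotient is defined once, as a formal power series, from the disc of radius 1. On
  every other disc, cancelling A shows that the same series is the local quotient V / U, which is
  bounded there.\<close>

theorem regular_imp_entire_multiple:
  assumes A: "entire A" "A \<noteq> 0" and B: "entire B" and reg: "\<And>x. regular_at B A x"
  obtains Q where "entire Q" "B = A * Q"
proof -
  have *: "\<exists>U V. entire U \<and> entire V \<and> strictly_dominant U r 0 \<and> B * U = A * V" if "r > 0" for r
    using cancel_zeros_in_disc[OF A(1) B A(2) that reg] .
  have U0: "fps_nth U 0 \<noteq> 0" if "strictly_dominant U r 0" "r > 0" for U r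
  proof
    assume "fps_nth U 0 = 0"
    moreover have "absval (fps_nth U 1) * r ^ 1 < absval (fps_nth U 0) * r ^ 0"
      using that(1) unfolding strictly_dominant_def by (metis one_neq_zero)
    ultimately show False
      using that(2) absval_nonneg[of "fps_nth U 1"] by (simp add: mult_less_0_iff)
  qed
  obtain U V where UV: "entire U" "entire V" "strictly_dominant U 1 0" "B * U = A * V"
    using *[of 1] by auto
  define Q where "Q = V * inverse U"
  have "U * Q = V * (inverse U * U)"
    by (simp add: Q_def mult_ac)
  then have UQ: "U * Q = V"
    using U0[OF UV(3)] by (simp add: inverse_mult_eq_1)
  have "U \<noteq> 0"
    using U0[OF UV(3)] by auto
  moreover have "B * U = A * Q * U"
    using UV(4) UQ by (simp add: mult_ac)
  ultimately have BQ: "B = A * Q"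
    by simp
  have "entire Q"
    unfolding entire_iff
  proof (intro allI impI)
    fix r :: real assume r: "r > 0"
    obtain U V where UV: "entire U" "entire V" "strictly_dominant U r 0" "B * U = A * V"
      using *[OF r] by auto
    have "A * (U * Q) = A * V"
      using UV(4) BQ by (simp add: mult_ac)
    then have "U * Q = V"
      using A(2) by simp
    moreover obtain M where "gauss_bound V r M"
      using UV(2) r entire_iff by blast
    ultimately show "\<exists>M. gauss_bound Q r M"
      using gauss_bound_quotient[OF UV(3)] r by blast
  qed
  with BQ show ?thesis
    using that by blast
qed

section \<open>Values and poles of meromorphic functions\<close>

lemma has_value_atE:
  assumes "has_value_at F x (v :: 'a)"
  obtains A B where "entire A" "entire B" "F = Fract A B" "B \<noteq> 0" "entire_eval B x \<noteq> 0"
    "v = entire_eval A x / entire_eval B x"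
proof -
  have "B \<noteq> 0" if "entire_eval B x \<noteq> 0" for B :: "'a fps"
    using that by auto
  then show ?thesis
    using assms that unfolding has_value_at_def by blast
qed

lemma has_value_atI:
  "entire A \<Longrightarrow> entire B \<Longrightarrow> entire_eval B x \<noteq> (0 :: 'a) \<Longrightarrow>
    has_value_at (Fract A B) x (entire_eval A x / entire_eval B x)"
  unfolding has_value_at_def by blast

lemma has_value_at_entire: "entire A \<Longrightarrow> has_value_at (Fract A 1) x (entire_eval A (x :: 'a))"
  using has_value_atI[of A 1 x] by simp

lemma has_value_at_unique:
  assumes "has_value_at F x (v :: 'a)" "has_value_at F x w"
  shows "v = w"
proof -
  obtain A B where 1: "entire A" "entire B" "F = Fract A B" "B \<noteq> 0" "entire_eval B x \<noteq> 0"
    "v = entire_eval A x / entire_eval B x"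
    using assms(1) by (rule has_value_atE)
  obtain C D where 2: "entire C" "entire D" "F = Fract C D" "D \<noteq> 0" "entire_eval D x \<noteq> 0"
    "w = entire_eval C x / entire_eval D x"
    using assms(2) by (rule has_value_atE)
  have "A * D = C * B"
    using 1(3,4) 2(3,4) by (simp add: eq_fract)
  then have "entire_eval (A * D) x = entire_eval (C * B) x"
    by simp
  then show ?thesis
    using 1 2 by (simp add: entire_eval_mult frac_eq_eq)
qed

lemma has_value_at_mult:
  assumes "has_value_at F x (v :: 'a)" "has_value_at G x w"
  shows "has_value_at (F * G) x (v * w)"
proof -
  obtain A B where 1: "entire A" "entire B" "F = Fract A B" "B \<noteq> 0" "entire_eval B x \<noteq> 0"
    "v = entire_eval A x / entire_eval B x"
    using assms(1) by (rule has_value_atE)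
  obtain C D where 2: "entire C" "entire D" "G = Fract C D" "D \<noteq> 0" "entire_eval D x \<noteq> 0"
    "w = entire_eval C x / entire_eval D x"
    using assms(2) by (rule has_value_atE)
  show ?thesis
    using 1 2 has_value_atI[of "A * C" "B * D" x] by (simp add: entire_mult entire_eval_mult)
qed

lemma has_value_at_add_const:
  assumes "has_value_at F x (v :: 'a)"
  shows "has_value_at (F + Fract (fps_const c) 1) x (v + c)"
proof -
  obtain A B where 1: "entire A" "entire B" "F = Fract A B" "B \<noteq> 0" "entire_eval B x \<noteq> 0"
    "v = entire_eval A x / entire_eval B x"
    using assms(1) by (rule has_value_atE)
  show ?thesis
    using 1 has_value_atI[of "A + fps_const c * B" B x]
    by (simp add: entire_mult entire_add entire_eval_mult entire_eval_add add_divide_distrib)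
qed

lemma meromorphicE:
  assumes "F \<in> (meromorphic_functions :: 'a fps fract set)"
  obtains A B where "entire A" "entire B" "B \<noteq> 0" "F = Fract A B"
  using assms unfolding meromorphic_functions_def by blast

lemma meromorphicI: "entire A \<Longrightarrow> entire B \<Longrightarrow> B \<noteq> (0 :: 'a fps) \<Longrightarrow> Fract A B \<in> meromorphic_functions"
  unfolding meromorphic_functions_def by blast

lemma meromorphic_inverse:
  assumes "F \<in> (meromorphic_functions :: 'a fps fract set)"
  shows "inverse F \<in> meromorphic_functions"
proof -
  obtain A B where *: "entire A" "entire B" "B \<noteq> 0" "F = Fract A B"
    using assms by (rule meromorphicE)
  show ?thesis
  proof (cases "A = 0")
    case True
    then show ?thesis
      using meromorphicI[of 0 1] * by (simp add: fract_collapse)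
  next
    case False
    then show ?thesis
      using * meromorphicI[of B A] by simp
  qed
qed

lemma meromorphic_add_const:
  assumes "F \<in> (meromorphic_functions :: 'a fps fract set)"
  shows "F + Fract (fps_const c) 1 \<in> meromorphic_functions"
proof -
  obtain A B where *: "entire A" "entire B" "B \<noteq> 0" "F = Fract A B"
    using assms(1) by (rule meromorphicE)
  show ?thesis
    using * meromorphicI[of "A + fps_const c * B" B] by (simp add: entire_mult entire_add)
qed

text \<open>A pole is encoded as a zero of the inverse. While numerator and denominator both vanish
  at x, a common factor is cancelled; the largest dominant index of the denominator limits how
  often.\<close>

lemma value_or_pole:
  assumes "F \<in> (meromorphic_functions :: 'a fps fract set)"
  shows "(\<exists>v. has_value_at F x v) \<or> has_value_at (inverse F) x 0"
proof -
  obtain A B where *: "entire A" "entire B" "B \<noteq> 0" "F = Fract A B"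
    using assms(1) by (rule meromorphicE)
  define r where "r = absval x + 1"
  have r: "absval x \<le> r" "r > 0"
    using absval_nonneg[of x] by (auto simp: r_def)
  show ?thesis
    using *
  proof (induction "Max (dominant_indices B r)" arbitrary: A B rule: less_induct)
    case less
    consider "entire_eval B x \<noteq> 0" | "entire_eval A x \<noteq> 0" "entire_eval B x = 0"
      | "entire_eval A x = 0" "entire_eval B x = 0"
      by blast
    then show ?case
    proof cases
      case 1
      then show ?thesis
        using has_value_atI[of A B x] less.prems by auto
    next
      case 2
      then show ?thesis
        using has_value_atI[of B A x] less.prems by auto
    next
      case 3
      obtain A1 where A1: "entire A1" "A = (fps_X - fps_const x) * A1"
        using entire_zero_factor less.prems 3 by blast
      obtain B1 where B1: "entire B1" "B = (fps_X - fps_const x) * B1"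
        using entire_zero_factor less.prems 3 by blast
      have "B1 \<noteq> 0"
        using less.prems B1 by auto
      moreover have "F = Fract A1 B1"
        using less.prems(4) A1 B1 by (simp add: mult_fract_cancel)
      ultimately show ?thesis
        using less.hyps[of B1 A1] A1 B1 Max_dominant_indices_linear_mult[OF B1(1) _ r] by auto
    qed
  qed
qed

text \<open>Having a value at x gives \<open>regular_at\<close> at x for any representation as a
  quotient, so the denominator divides the numerator.\<close>

theorem meromorphic_without_poles:
  assumes "F \<in> (meromorphic_functions :: 'a fps fract set)" "\<And>x. \<exists>v. has_value_at F x v"
  obtains Q where "entire Q" "F = Fract Q 1"
proof -
  obtain B A where *: "entire B" "entire A" "A \<noteq> 0" "F = Fract B A"
    using assms(1) by (rule meromorphicE)
  have "regular_at B A x" for x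
  proof -
    obtain v where "has_value_at F x v"
      using assms(2) by blast
    then obtain B' A' where "entire B'" "entire A'" "F = Fract B' A'" "A' \<noteq> 0" "entire_eval A' x \<noteq> 0"
      by (rule has_value_atE)
    moreover from this have "B * A' = A * B'"
      using * by (simp add: eq_fract mult.commute)
    ultimately show ?thesis
      unfolding regular_at_def by blast
  qed
  then obtain Q where "entire Q" "B = A * Q"
    using regular_imp_entire_multiple[OF *(2,3,1)] by blast
  then show ?thesis
    using that[of Q] * by (simp add: eq_fract mult.commute)
qed

end

section \<open>Poles of the factors of an entire function\<close>

lemma rational_function_const: "rational_function (Fract (fps_const c) 1)"
  unfolding rational_function_def
  by (intro exI[of _ "[:c:]"] exI[of _ 1]) (simp add: fps_of_poly_const)

lemma rational_function_of_polys:
  assumes "Q \<noteq> 0"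
  shows "rational_function (Fract (fps_of_poly P) (fps_of_poly Q))"
  using assms unfolding rational_function_def by blast

lemma linear_power_fps_of_poly:
  "(fps_X - fps_const (c :: 'a :: comm_ring_1)) ^ k = fps_of_poly ([:- c, 1:] ^ k)"
proof -
  have "fps_of_poly [:- c, 1:] = fps_X - fps_const c"
    by (simp add: fps_of_poly_pCons fps_eq_iff)
  then show ?thesis
    by (simp only: fps_of_poly_power)
qed

context padic_complex_field
begin

text \<open>The zeros of A - v B are isolated, so the nearby values differ from v. Approaching v
  through other points is what allows g to be inserted into statements about f that hold only in a
  punctured neighbourhood.\<close>

lemma has_value_at_near:
  assumes "has_value_at F x (v :: 'a)" "F \<noteq> Fract (fps_const v) 1"
  obtains \<phi> where "\<forall>\<^sub>F y in at x. has_value_at F y (\<phi> y)" "filterlim \<phi> (at v) (at x)"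
proof -
  obtain A B where *: "entire A" "entire B" "F = Fract A B" "B \<noteq> 0" "entire_eval B x \<noteq> 0"
    "v = entire_eval A x / entire_eval B x"
    using assms(1) by (rule has_value_atE)
  define \<phi> where "\<phi> y = entire_eval A y / entire_eval B y" for y
  have B: "\<forall>\<^sub>F y in at x. entire_eval B y \<noteq> 0"
    using * by (intro eventually_entire_neq_0)
  have "A - fps_const v * B \<noteq> 0"
    using assms(2) * by (auto simp: eq_fract)
  then have "\<forall>\<^sub>F y in at x. entire_eval (A - fps_const v * B) y \<noteq> 0"
    using * by (intro eventually_entire_neq_0 entire_diff entire_mult entire_const)
  with B have "\<forall>\<^sub>F y in at x. \<phi> y \<noteq> v"
  proof eventually_elim
    case (elim y)
    then show ?case
      using *(1,2) by (simp add: \<phi>_def entire_eval_diff entire_eval_mult entire_mult nonzero_divide_eq_eq)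
  qed
  moreover have "(\<phi> \<longlongrightarrow> v) (at x)"
    unfolding \<phi>_def using * by (simp add: tendsto_divide_nonarch tendsto_entire_eval)
  ultimately have "filterlim \<phi> (at v) (at x)"
    by (simp add: filterlim_at)
  moreover have "\<forall>\<^sub>F y in at x. has_value_at F y (\<phi> y)"
    using B
  proof eventually_elim
    case (elim y)
    then show ?case
      using * by (simp add: \<phi>_def has_value_atI)
  qed
  ultimately show ?thesis
    using that by blast
qed

text \<open>If \<open>g\<close> took a pole of \<open>f\<close> as a value, \<open>f \<circ> g\<close> would have a pole.\<close>

lemma composition_omits_pole:
  assumes F: "entire F" and comp: "is_composition (Fract F 1) f g"
    and f: "f \<noteq> 0" "has_value_at (inverse f) b 0"
    and g: "g \<noteq> Fract (fps_const b) 1" "has_value_at g x (b :: 'a)"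
  shows False
proof -
  obtain \<phi> where \<phi>: "\<forall>\<^sub>F y in at x. has_value_at g y (\<phi> y)" "filterlim \<phi> (at b) (at x)"
    using has_value_at_near[OF g(2,1)] .
  obtain D C where *: "entire D" "entire C" "inverse f = Fract D C" "C \<noteq> 0" "entire_eval C b \<noteq> 0"
    "0 = entire_eval D b / entire_eval C b"
    using f(2) by (rule has_value_atE)
  have fCD: "f = Fract C D"
    using *(3) by (metis inverse_fract inverse_inverse_eq)
  with f(1) have "D \<noteq> 0"
    by (auto simp: fract_collapse)
  then have "\<forall>\<^sub>F y in at b. entire_eval D y \<noteq> 0"
    using * by (intro eventually_entire_neq_0)
  then have "\<forall>\<^sub>F y in at x. entire_eval D (\<phi> y) \<noteq> 0"
    using \<phi>(2) by (rule eventually_compose_filterlim)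
  \<comment> \<open>The denominator is multiplied out so that the equation passes to the limit,
    where it reads F x * 0 = C b with C b nonzero.\<close>
  with \<phi>(1) have "\<forall>\<^sub>F y in at x. entire_eval F y * entire_eval D (\<phi> y) = entire_eval C (\<phi> y)"
  proof eventually_elim
    case (elim y)
    then have "has_value_at f (\<phi> y) (entire_eval C (\<phi> y) / entire_eval D (\<phi> y))"
      using * fCD by (simp add: has_value_atI)
    then have "has_value_at (Fract F 1) y (entire_eval C (\<phi> y) / entire_eval D (\<phi> y))"
      using comp elim unfolding is_composition_def by blast
    then have "entire_eval C (\<phi> y) / entire_eval D (\<phi> y) = entire_eval F y"
      using has_value_at_entire[OF F] by (rule has_value_at_unique)
    then show ?case
      using elim by (simp add: field_simps)
  qed
  moreover have lim: "(\<phi> \<longlongrightarrow> b) (at x)"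
    using \<phi>(2) by (simp add: filterlim_at)
  have "((\<lambda>y. entire_eval F y * entire_eval D (\<phi> y)) \<longlongrightarrow> entire_eval F x * entire_eval D b) (at x)"
    using F * lim by (intro tendsto_mult tendsto_entire_eval tendsto_ident_at)
  ultimately have "((\<lambda>y. entire_eval C (\<phi> y)) \<longlongrightarrow> entire_eval F x * entire_eval D b) (at x)"
    by (rule Lim_transform_eventually[rotated])
  moreover have "((\<lambda>y. entire_eval C (\<phi> y)) \<longlongrightarrow> entire_eval C b) (at x)"
    using * lim by (intro tendsto_entire_eval)
  ultimately have "entire_eval F x * entire_eval D b = entire_eval C b"
    using tendsto_unique[OF at_neq_bot] by blast
  with * show False
    by simp
qed

lemma eventually_absval_eq:
  assumes A: "entire A" "entire_eval A (x :: 'a) \<noteq> 0"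
  shows "\<forall>\<^sub>F y in at x. absval (entire_eval A y) = absval (entire_eval A x)"
proof -
  have "((\<lambda>y. entire_eval A y) \<longlongrightarrow> entire_eval A x) (at x)"
    using A by (intro tendsto_entire_eval tendsto_ident_at)
  then have "((\<lambda>y. absval (entire_eval A y - entire_eval A x)) \<longlongrightarrow> 0) (at x)"
    using tendsto_absval_iff by blast
  then have "\<forall>\<^sub>F y in at x. absval (entire_eval A y - entire_eval A x) < absval (entire_eval A x)"
    using A by (intro order_tendstoD) auto
  then show ?thesis
  proof eventually_elim
    case (elim y)
    then show ?case
      using absval_add_eq[of "entire_eval A y - entire_eval A x" "entire_eval A x"] by simp
  qed
qed

text \<open>
  Near a pole of \<open>g\<close> the function \<open>f \<circ> g\<close> is bounded while the absolute value of \<open>g\<close> runs through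
  a dense set of large numbers. So \<open>f\<close> is bounded near infinity.
\<close>

lemma composition_outer_polynomial:
  assumes F: "entire F" and comp: "is_composition (Fract F 1) f g"
    and E: "entire (E :: 'a fps)" and f: "f = Fract E ((fps_X - fps_const b) ^ k)"
    and g: "g \<noteq> 0" "has_value_at (inverse g) x0 0"
  shows "\<exists>P. E = fps_of_poly P"
proof (rule ccontr)
  assume not_poly: "\<nexists>P. E = fps_of_poly P"
  \<comment> \<open>A coefficient beyond k makes \<open>E\<close> grow faster than the k-th power
    that the denominator of f can absorb.\<close>
  have "\<exists>j>k. fps_nth E j \<noteq> 0"
  proof (rule ccontr)
    assume "\<not> ?thesis"
    then have "E = fps_of_poly (Poly (map (fps_nth E) [0..<Suc k]))"
      by (auto simp: fps_eq_iff nth_default_def simp del: upt_Suc)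
    with not_poly show False by blast
  qed
  then obtain j where j: "j > k" "fps_nth E j \<noteq> 0"
    by blast
  then have "E \<noteq> 0" by auto
  obtain P Q where PQ: "entire P" "entire Q" "inverse g = Fract P Q" "Q \<noteq> 0" "entire_eval Q x0 \<noteq> 0"
    "0 = entire_eval P x0 / entire_eval Q x0"
    using g(2) by (rule has_value_atE)
  have gQP: "g = Fract Q P"
    using PQ(3) by (metis inverse_fract inverse_inverse_eq)
  with g(1) have "P \<noteq> 0"
    by (auto simp: fract_collapse)
  then obtain m P1 where P1: "entire P1" "P = (fps_X - fps_const x0) ^ m * P1" "entire_eval P1 x0 \<noteq> 0"
    using entire_factor_order[OF PQ(1)] by metis
  have m: "m > 0"
    using P1 PQ by (cases m) auto
  \<comment> \<open>Near x0, |g x| equals \<open>\<kappa>\<close> / |x - x0|^m.\<close>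
  define \<kappa> where "\<kappa> = absval (entire_eval Q x0) / absval (entire_eval P1 x0)"
  have \<kappa>: "\<kappa> > 0"
    using P1 PQ by (simp add: \<kappa>_def)
  define K where "K = absval (entire_eval F x0) + 1"
  have "((\<lambda>x. absval (entire_eval F x)) \<longlongrightarrow> absval (entire_eval F x0)) (at x0)"
    using F by (intro tendsto_absval tendsto_entire_eval tendsto_ident_at)
  then have "\<forall>\<^sub>F x in at x0. absval (entire_eval F x) < K"
    by (rule order_tendstoD) (simp add: K_def)
  moreover note eventually_absval_eq[OF P1(1,3)] eventually_absval_eq[OF PQ(2,5)]
  ultimately have "\<forall>\<^sub>F x in at x0. absval (entire_eval F x) < K \<and>
      absval (entire_eval P1 x) = absval (entire_eval P1 x0) \<and>
      absval (entire_eval Q x) = absval (entire_eval Q x0)"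
    by eventually_elim blast
  then obtain d where d: "d > 0" "\<And>x. 0 < absval (x - x0) \<Longrightarrow> absval (x - x0) < d \<Longrightarrow>
      absval (entire_eval F x) < K \<and>
      absval (entire_eval P1 x) = absval (entire_eval P1 x0) \<and>
      absval (entire_eval Q x) = absval (entire_eval Q x0)"
    unfolding eventually_at by (auto simp: dist_absval)
  have "filterlim (\<lambda>s. absval (fps_nth E j) * s ^ (j - k)) at_top (at_top :: real filter)"
    using j by (intro filterlim_tendsto_pos_mult_at_top[OF tendsto_const] filterlim_pow_at_top filterlim_ident) auto
  then have "\<forall>\<^sub>F s in at_top. K < absval (fps_nth E j) * s ^ (j - k)"
    by (simp add: filterlim_at_top_dense)
  then obtain S0 where S0: "\<And>s. s \<ge> S0 \<Longrightarrow> K < absval (fps_nth E j) * s ^ (j - k)"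
    unfolding eventually_at_top_linorder by blast
  define S where "S = max S0 (max (absval b) (\<kappa> / d ^ m)) + 1"
  have S: "S > S0" "S > absval b" "S > \<kappa> / d ^ m" "S > 0"
    using absval_nonneg[of b] by (auto simp: S_def)
  define n where "n = Max (dominant_indices E S)"
  obtain S' where S': "S' > S" "\<And>s. S < s \<Longrightarrow> s < S' \<Longrightarrow> strictly_dominant E s n"
    using eventually_strictly_dominant_right[OF E \<open>E \<noteq> 0\<close> S(4)]
    unfolding n_def[symmetric] eventually_at_right_field by blast
  \<comment> \<open>z is chosen so that s = |g (x0 + z)| falls in (S, S'), where a single index of
    \<open>E\<close> is strictly dominant.\<close>
  have "root m (\<kappa> / S') < root m (\<kappa> / S)"
    using m \<kappa> S S' by (simp add: frac_less2)
  moreover have "root m (\<kappa> / S) > 0"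
    using m \<kappa> S by simp
  ultimately obtain z :: 'a where z: "root m (\<kappa> / S') < absval z" "absval z < root m (\<kappa> / S)"
    by (rule absval_dense)
  have "root m (\<kappa> / S') > 0"
    using m \<kappa> S S' by simp
  with z have z0: "absval z > 0" by linarith
  have zm: "\<kappa> / S' < absval z ^ m" "absval z ^ m < \<kappa> / S"
  proof -
    have "root m (\<kappa> / S') ^ m < absval z ^ m"
      using z m \<open>root m (\<kappa> / S') > 0\<close> by (intro power_strict_mono) auto
    then show "\<kappa> / S' < absval z ^ m"
      using m \<kappa> S S' by simp
    have "absval z ^ m < root m (\<kappa> / S) ^ m"
      using z m by (intro power_strict_mono absval_nonneg) auto
    then show "absval z ^ m < \<kappa> / S"
      using m \<kappa> S by simp
  qed
  define s where "s = \<kappa> / absval z ^ m"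
  have zm0: "absval z ^ m > 0"
    using z0 by (rule zero_less_power)
  have s: "S < s" "s < S'"
    using zm S S' zm0 by (simp_all add: s_def field_simps)
  have "\<kappa> / S < d ^ m"
    using S d by (simp add: field_simps)
  with zm have "absval z ^ m < d ^ m"
    by linarith
  then have zd: "absval z < d"
    using d by (intro power_less_imp_less_base[of _ m d]) auto
  define x where "x = x0 + z"
  have x: "absval (entire_eval F x) < K" "absval (entire_eval P1 x) = absval (entire_eval P1 x0)"
    "absval (entire_eval Q x) = absval (entire_eval Q x0)"
    using d(2)[of x] z0 zd by (auto simp: x_def)
  have Px: "absval (entire_eval P x) = absval z ^ m * absval (entire_eval P1 x0)"
    using P1 x by (simp add: entire_eval_mult entire_eval_power entire_power absval_mult absval_power x_def)
  then have "entire_eval P x \<noteq> 0"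
    using zm0 P1 by (metis absval_eq_0_iff mult_eq_0_iff less_irrefl)
  define y where "y = entire_eval Q x / entire_eval P x"
  have gy: "has_value_at g x y"
    using \<open>entire_eval P x \<noteq> 0\<close> PQ gQP by (simp add: y_def has_value_atI)
  have y: "absval y = s"
    by (simp add: y_def absval_divide Px x s_def \<kappa>_def)
  have yb: "absval (y - b) = s"
    using absval_diff_eq[of b y] y s S by simp
  then have "y - b \<noteq> 0"
    using s S by auto
  then have "has_value_at f y (entire_eval E y / (y - b) ^ k)"
    using has_value_atI[of E "(fps_X - fps_const b) ^ k" y] E f
    by (simp add: entire_power entire_eval_power)
  with gy have "has_value_at (Fract F 1) x (entire_eval E y / (y - b) ^ k)"
    using comp unfolding is_composition_def by blast
  then have "entire_eval E y / (y - b) ^ k = entire_eval F x"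
    using has_value_at_entire[OF F] by (rule has_value_at_unique)
  then have "entire_eval E y = entire_eval F x * (y - b) ^ k"
    using \<open>y - b \<noteq> 0\<close> by (simp add: field_simps)
  then have "absval (entire_eval E y) \<le> K * s ^ k"
    using x(1) s S by (simp add: absval_mult absval_power yb mult_right_mono)
  also have "K * s ^ k < absval (fps_nth E j) * s ^ (j - k) * s ^ k"
    using S0[of s] s S by (intro mult_strict_right_mono) auto
  also have "\<dots> = absval (fps_nth E j) * s ^ j"
    using j by (simp add: mult.assoc flip: power_add)
  also have "\<dots> \<le> absval (fps_nth E n) * s ^ n"
    using S'(2)[OF s] unfolding strictly_dominant_def by (cases "j = n") (auto intro: less_imp_le)
  also have "\<dots> = absval (entire_eval E y)"
    using absval_entire_eval_strictly_dominant[OF E] S'(2)[OF s] y by metis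
  finally show False by simp
qed

theorem composition_entire_imp_entire:
  assumes F: "entire (F :: 'a fps)" and comp: "is_composition (Fract F 1) f g"
    and fM: "f \<in> meromorphic_functions" and gM: "g \<in> meromorphic_functions"
    and f_nr: "\<not> rational_function f" and g_nr: "\<not> rational_function g"
  obtains E G where "entire E" "entire G" "f = Fract E 1" "g = Fract G 1"
proof -
  have g_const: "g \<noteq> Fract (fps_const c) 1" for c
    using g_nr rational_function_const by auto
  have f0: "f \<noteq> 0" and g0: "g \<noteq> 0"
    using f_nr g_nr rational_function_const[of "0 :: 'a"] by (auto simp: fract_collapse)
  \<comment> \<open>Stated with a denominator so that it serves twice: for an assumed pole b of f,
    and with k = 0 for an entire f.\<close>
  have no_pole: "\<not> has_value_at (inverse g) x 0"
    if E: "entire E" and fE: "f = Fract E ((fps_X - fps_const b) ^ k)" for E b k x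
  proof
    assume "has_value_at (inverse g) x 0"
    then obtain P where "E = fps_of_poly P"
      using composition_outer_polynomial[OF F comp E fE g0] by blast
    then have "rational_function f"
      using rational_function_of_polys[of "[:- b, 1:] ^ k" P] fE by (simp add: linear_power_fps_of_poly)
    with f_nr show False ..
  qed
  have f_val: "\<exists>v. has_value_at f b v" for b
  proof (rule ccontr)
    assume "\<nexists>v. has_value_at f b v"
    then have pole: "has_value_at (inverse f) b 0"
      using value_or_pole[OF fM] by blast
    \<comment> \<open>g - b has no zero because g omits b, so its inverse, called \<open>H\<close>
      below, is entire.\<close>
    define g1 where "g1 = g + Fract (fps_const (- b)) 1"
    have g1M: "inverse g1 \<in> meromorphic_functions"
      using gM unfolding g1_def by (intro meromorphic_inverse meromorphic_add_const)
    have g_eq: "g = g1 + Fract (fps_const b) 1"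
      by (simp add: g1_def eq_fract algebra_simps Zero_fract_def flip: fps_const_neg)
    have "\<exists>v. has_value_at (inverse g1) x v" for x
    proof (rule ccontr)
      assume "\<nexists>v. has_value_at (inverse g1) x v"
      then have "has_value_at g1 x 0"
        using value_or_pole[OF g1M] by fastforce
      then have "has_value_at g x b"
        unfolding g_eq using has_value_at_add_const[of g1 x 0 b] by simp
      then show False
        using composition_omits_pole[OF F comp f0 pole g_const] by blast
    qed
    then obtain H where H: "entire H" "inverse g1 = Fract H 1"
      using meromorphic_without_poles[OF g1M] by blast
    then have g1: "g1 = Fract 1 H"
      by (metis inverse_fract inverse_inverse_eq)
    have "g1 \<noteq> 0"
      using g_const[of b] unfolding g_eq by auto
    then have "H \<noteq> 0"
      using g1 by (auto simp: fract_collapse)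
    have "\<exists>n>0. fps_nth H n \<noteq> 0"
    proof (rule ccontr)
      assume "\<not> ?thesis"
      then have const: "H = fps_const (fps_nth H 0)"
        unfolding fps_eq_iff by (metis bot_nat_0.not_eq_extremum fps_nth_fps_const)
      with \<open>H \<noteq> 0\<close> have "fps_nth H 0 \<noteq> 0"
        by auto
      then have "1 = fps_const (inverse (fps_nth H 0)) * H"
        by (subst const) simp
      then have "g1 = Fract (fps_const (inverse (fps_nth H 0))) 1"
        using g1 \<open>H \<noteq> 0\<close> by (simp add: eq_fract)
      then have "g = Fract (fps_const (inverse (fps_nth H 0) + b)) 1"
        by (simp add: g_eq)
      with g_const show False by blast
    qed
    then obtain n where n: "n > 0" "fps_nth H n \<noteq> 0"
      by blast
    have other: "\<exists>v. has_value_at f c v" if "c \<noteq> b" for c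
    proof (rule ccontr)
      assume "\<nexists>v. has_value_at f c v"
      then have pole': "has_value_at (inverse f) c 0"
        using value_or_pole[OF fM] by blast
      \<comment> \<open>At such an x the value of g is c, which g would have to omit as
        well.\<close>
      obtain x where x: "entire_eval H x = inverse (c - b)"
        using entire_surj[OF H(1) n] by blast
      then have "has_value_at g1 x (c - b)"
        using has_value_atI[of 1 H x] H(1) g1 that by (simp add: divide_inverse)
      then have "has_value_at g x c"
        unfolding g_eq using has_value_at_add_const[of g1 x "c - b" b] by simp
      then show False
        using composition_omits_pole[OF F comp f0 pole' g_const] by blast
    qed
    \<comment> \<open>As f has no pole other than b, only a power of X - b needs to remain in its
      denominator.\<close>
    obtain C D where CD: "entire C" "entire D" "D \<noteq> 0" "f = Fract C D"
      using fM by (rule meromorphicE)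
    obtain k D1 where D1: "entire D1" "D = (fps_X - fps_const b) ^ k * D1" "entire_eval D1 b \<noteq> 0"
      using entire_factor_order[OF CD(2,3)] .
    define f2 where "f2 = f * Fract ((fps_X - fps_const b) ^ k) 1"
    have f2: "f2 = Fract C D1"
      using CD D1 by (auto simp: f2_def eq_fract mult_ac)
    have "f2 \<in> meromorphic_functions"
      unfolding f2 using CD D1 by (intro meromorphicI) auto
    moreover have "\<exists>v. has_value_at f2 x v" for x
    proof (cases "x = b")
      case True
      then show ?thesis
        unfolding f2 using has_value_atI[of C D1 b] CD D1 by blast
    next
      case False
      then obtain v where "has_value_at f x v"
        using other by blast
      then show ?thesis
        unfolding f2_def using has_value_at_mult has_value_at_entire entire_power entire_linear by meson
    qed
    ultimately obtain E where E: "entire E" "f2 = Fract E 1"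
      using meromorphic_without_poles by blast
    have "C = E * D1"
      using E f2 D1 CD by (auto simp: eq_fract)
    then have fE: "f = Fract E ((fps_X - fps_const b) ^ k)"
      using CD D1 by (auto simp: eq_fract mult_ac)
    \<comment> \<open>A zero of 1 / (g - b) is a pole of g, which \<open>no_pole\<close>
      excludes.\<close>
    obtain x where x: "entire_eval H x = 0"
      using entire_surj[OF H(1) n] by blast
    have "g = Fract (1 + fps_const b * H) H"
      using \<open>H \<noteq> 0\<close> by (simp add: g_eq g1)
    then have "inverse g = Fract H (1 + fps_const b * H)"
      by simp
    then have "has_value_at (inverse g) x 0"
      using has_value_atI[of H "1 + fps_const b * H" x] H(1) x
      by (simp add: entire_add entire_mult entire_eval_add entire_eval_mult)
    with no_pole[OF E(1) fE] show False by blast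
  qed
  then obtain E where E: "entire E" "f = Fract E 1"
    using meromorphic_without_poles[OF fM] by blast
  have "\<exists>v. has_value_at g x v" for x
    using value_or_pole[OF gM, of x] no_pole[OF E(1), of 0 0 x] E(2) by auto
  then obtain G where "entire G" "g = Fract G 1"
    using meromorphic_without_poles[OF gM] by blast
  with E show ?thesis
    using that by blast
qed

end

section \<open>Dominant indices of compositions\<close>

lemma strictly_dominant_nth_neq_0:
  assumes "strictly_dominant A r n" "r \<ge> 0"
  shows "fps_nth A n \<noteq> 0"
proof
  assume "fps_nth A n = 0"
  moreover have "absval (fps_nth A (Suc n)) * r ^ Suc n < absval (fps_nth A n) * r ^ n"
    using assms(1) unfolding strictly_dominant_def by (metis n_not_Suc_n)
  moreover have "absval (fps_nth A (Suc n)) * r ^ Suc n \<ge> 0"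
    using assms(2) by (intro mult_nonneg_nonneg zero_le_power absval_nonneg)
  ultimately show False
    by simp
qed

text \<open>The quotient of two positive monomials with different exponents is strictly monotone, so
  it equals 1 at one radius at most.\<close>

lemma monomials_agree_twice:
  fixes a b r s :: real
  assumes "a > 0" "b > 0" "0 < r" "r < s" "a * r ^ m = b * r ^ n" "a * s ^ m = b * s ^ n"
  shows "m = n"
proof -
  have *: "\<not> m < n" if "a > 0" "b > 0" "a * r ^ m = b * r ^ n" "a * s ^ m = b * s ^ n"
    for a b :: real and m n
  proof
    assume "m < n"
    then have pow: "x ^ n = x ^ (n - m) * x ^ m" for x :: real
      by (simp flip: power_add)
    have "a = b * r ^ (n - m)" "a = b * s ^ (n - m)"
      using that(3,4) assms(3,4) unfolding pow by simp_all
    moreover have "r ^ (n - m) < s ^ (n - m)"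
      using \<open>m < n\<close> assms(3,4) by (intro power_strict_mono) auto
    ultimately show False
      using \<open>b > 0\<close> by simp
  qed
  show ?thesis
    using *[of a b m n] *[of b a n m] assms by (metis linorder_neqE_nat)
qed

text \<open>Dominance of m over m + 1 says R <= |a_m / a_(m+1)|, dominance of n over n - 1 says
  |a_(n-1) / a_n| <= R. Strictly increasing ratios leave no room for m < n - 1.\<close>

lemma dominant_indices_at_most_consecutive:
  fixes F :: "'a :: nonarch_field fps"
  assumes nz: "\<And>n. n \<ge> n0 \<Longrightarrow> fps_nth F n \<noteq> 0"
    and mono: "strict_mono_on {n0..} (\<lambda>n. absval (fps_nth F n / fps_nth F (Suc n)))"
    and R: "R > 0" and dom: "\<forall>i\<in>dominant_indices F R. i \<ge> n0"
    and mn: "m \<in> dominant_indices F R" "n \<in> dominant_indices F R"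
  shows "n \<le> Suc m"
proof (rule ccontr)
  assume "\<not> n \<le> Suc m"
  then obtain k where k: "n = Suc k" "m < k"
    by (cases n) auto
  have "m \<ge> n0"
    using dom mn by blast
  have "absval (fps_nth F (Suc m)) * R * R ^ m \<le> absval (fps_nth F m) * R ^ m"
    using dominant_indicesD[OF mn(1), of "Suc m"] by (simp add: mult_ac)
  then have 1: "R \<le> absval (fps_nth F m / fps_nth F (Suc m))"
    using nz[of "Suc m"] \<open>m \<ge> n0\<close> R by (simp add: absval_divide field_simps absval_eq_0_iff)
  have "absval (fps_nth F k) * R ^ k \<le> absval (fps_nth F n) * R * R ^ k"
    using dominant_indicesD[OF mn(2), of k] k by (simp add: mult_ac)
  then have 2: "absval (fps_nth F k / fps_nth F (Suc k)) \<le> R"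
    using nz[of n] k \<open>m \<ge> n0\<close> R by (simp add: absval_divide field_simps absval_eq_0_iff)
  have "absval (fps_nth F m / fps_nth F (Suc m)) < absval (fps_nth F k / fps_nth F (Suc k))"
    using strict_mono_onD[OF mono, of m k] k \<open>m \<ge> n0\<close> by simp
  with 1 2 show False
    by linarith
qed

context padic_complex_field
begin

text \<open>Let d be dominant at R0. Larger indices take over eventually, so there is a last radius
  R at which d is still dominant. If d were the largest dominant index there, it would stay dominant
  just above R.\<close>

lemma ex_critical_radius:
  assumes G: "entire (G :: 'a fps)" "\<And>n. \<exists>j>n. fps_nth G j \<noteq> 0" and R0: "R0 > 0"
  obtains R where "R \<ge> R0" "Min (dominant_indices G R) < Max (dominant_indices G R)"
proof -
  have "G \<noteq> 0"
    using G(2) by auto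
  define d where "d = Max (dominant_indices G R0)"
  define X where "X = {R. R0 \<le> R \<and> d \<in> dominant_indices G R}"
  have d: "d \<in> dominant_indices G R0"
    unfolding d_def using dominant_indices_finite_nonempty[OF G(1) \<open>G \<noteq> 0\<close> R0] by (rule Max_in)
  then have "X \<noteq> {}"
    by (auto simp: X_def)
  obtain j where "j > d" "fps_nth G j \<noteq> 0"
    using G(2) by blast
  then obtain B where B: "\<And>R. R \<ge> B \<Longrightarrow> \<forall>i\<in>dominant_indices G R. i \<ge> j"
    using eventually_dominant_indices_ge unfolding eventually_at_top_linorder by blast
  have "bdd_above X"
  proof (rule bdd_aboveI)
    fix R assume "R \<in> X"
    then show "R \<le> B"
      using B[of R] \<open>j > d\<close> by (force simp: X_def)
  qed
  \<comment> \<open>Each condition in the intersection is closed, so the supremum belongs to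
    \<open>X\<close>.\<close>
  have "X = {R. R0 \<le> R} \<inter> (\<Inter>i. {R. absval (fps_nth G i) * R ^ i \<le> absval (fps_nth G d) * R ^ d})"
    by (auto simp: X_def dominant_indices_def)
  moreover have "closed \<dots>"
    by (intro closed_Int closed_INT ballI closed_Collect_le continuous_intros)
  ultimately have "closed X"
    by simp
  define R where "R = Sup X"
  have "R \<in> X"
    unfolding R_def using \<open>closed X\<close> \<open>X \<noteq> {}\<close> \<open>bdd_above X\<close> by (intro closed_contains_Sup)
  then have R: "R0 \<le> R" "R > 0" "d \<in> dominant_indices G R"
    using R0 by (auto simp: X_def)
  note dom = dominant_indices_finite_nonempty[OF G(1) \<open>G \<noteq> 0\<close> R(2)]
  have "Max (dominant_indices G R) \<noteq> d"
  proof
    assume "Max (dominant_indices G R) = d"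
    then have "\<forall>\<^sub>F r in at_right R. strictly_dominant G r d"
      using eventually_strictly_dominant_right[OF G(1) \<open>G \<noteq> 0\<close> R(2)] by simp
    then obtain b where b: "b > R" "\<And>r. R < r \<Longrightarrow> r < b \<Longrightarrow> strictly_dominant G r d"
      unfolding eventually_at_right_field by blast
    define r where "r = (R + b) / 2"
    have r: "R < r" "r < b"
      using b(1) by (simp_all add: r_def)
    then have "d \<in> dominant_indices G r"
      using b(2)[OF r] unfolding strictly_dominant_def dominant_indices_def mem_Collect_eq
      by (metis less_imp_le order_refl)
    then have "r \<in> X"
      using r R by (simp add: X_def)
    then have "r \<le> R"
      unfolding R_def using \<open>bdd_above X\<close> by (intro cSup_upper)
    with r show False by simp
  qed
  then have "d < Max (dominant_indices G R)"
    using Max_ge[OF dom(1) R(3)] by simp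
  then have "Min (dominant_indices G R) < Max (dominant_indices G R)"
    using Min_le[OF dom(1) R(3)] by simp
  with R(1) show ?thesis
    using that by blast
qed

text \<open>On the interval all three moduli are monomials, and |F x| = |E (G x)| equates one of
  exponent m with one of exponent k d. Density of the absolute values supplies two radii for the
  comparison.\<close>

lemma dominant_index_composition:
  assumes ent: "entire (F :: 'a fps)" "entire E" "entire G"
    and comp: "\<And>x. entire_eval F x = entire_eval E (entire_eval G x)"
    and ab: "0 \<le> a" "a < b"
    and sd: "\<And>r. a < r \<Longrightarrow> r < b \<Longrightarrow> strictly_dominant F r m \<and> strictly_dominant G r d \<and>
      strictly_dominant E (absval (fps_nth G d) * r ^ d) k"
  shows "m = k * d"
proof -
  have "0 < b"
    using ab by linarith
  then obtain x1 :: 'a where x1: "a < absval x1" "absval x1 < b"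
    using absval_dense[OF ab(2)] by blast
  obtain x2 :: 'a where x2: "absval x1 < absval x2" "absval x2 < b"
    using absval_dense[OF x1(2) \<open>0 < b\<close>] by blast
  have eq: "absval (fps_nth F m) * absval x ^ m
      = absval (fps_nth E k) * absval (fps_nth G d) ^ k * absval x ^ (k * d)"
    if "a < absval x" "absval x < b" for x :: 'a
  proof -
    have G: "absval (entire_eval G x) = absval (fps_nth G d) * absval x ^ d"
      using sd[OF that] ent by (simp add: absval_entire_eval_strictly_dominant)
    then have "absval (entire_eval E (entire_eval G x))
        = absval (fps_nth E k) * (absval (fps_nth G d) * absval x ^ d) ^ k"
      using absval_entire_eval_strictly_dominant[OF ent(2), of "entire_eval G x" k] sd[OF that] by simp
    moreover have "absval (entire_eval F x) = absval (fps_nth F m) * absval x ^ m"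
      using sd[OF that] ent by (simp add: absval_entire_eval_strictly_dominant)
    ultimately show ?thesis
      by (simp add: comp power_mult_distrib mult_ac flip: power_mult)
  qed
  have "fps_nth F m \<noteq> 0" "fps_nth G d \<noteq> 0"
    using sd[OF x1] strictly_dominant_nth_neq_0 absval_nonneg by blast+
  moreover have "fps_nth E k \<noteq> 0"
    using sd[OF x1]
    by (intro strictly_dominant_nth_neq_0[of E "absval (fps_nth G d) * absval x1 ^ d"])
      (auto intro!: mult_nonneg_nonneg zero_le_power absval_nonneg)
  ultimately show ?thesis
    using eq[OF x1] eq[of x2] x1 x2 ab
    by (intro monomials_agree_twice[of "absval (fps_nth F m)"
          "absval (fps_nth E k) * absval (fps_nth G d) ^ k" "absval x1" "absval x2"]) auto
qed

text \<open>
  On a logarithmic scale the dominant indices are the one-sided slopes of the maximum modulus,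
  so this is the chain rule.
\<close>

lemma dominant_indices_composition:
  assumes ent: "entire (F :: 'a fps)" "entire E" "entire G" and nz: "F \<noteq> 0" "E \<noteq> 0" "G \<noteq> 0"
    and comp: "\<And>x. entire_eval F x = entire_eval E (entire_eval G x)"
    and R: "R > 0" and d: "d \<in> dominant_indices G R" and pos: "\<forall>i\<in>dominant_indices G R. i > 0"
  defines "S \<equiv> absval (fps_nth G d) * R ^ d"
  shows "Min (dominant_indices F R) = Min (dominant_indices E S) * Min (dominant_indices G R)"
    and "Max (dominant_indices F R) = Max (dominant_indices E S) * Max (dominant_indices G R)"
proof -
  note dom = dominant_indices_finite_nonempty[OF ent(3) nz(3) R]
  have S: "S > 0"
    using dominant_indices_nth_neq_0[OF nz(3) R d] R by (simp add: S_def)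
  have lim: "((\<lambda>r. absval (fps_nth G i) * r ^ i) \<longlongrightarrow> S) (at R within Z)"
    if "i \<in> dominant_indices G R" for i Z
    unfolding S_def dominant_indices_eq_value[OF d that] by (intro tendsto_intros)
  \<comment> \<open>Positive indices make the dominant terms of G strictly increasing in r: radii
    below R go to radii below S, radii above R to radii above S, so the one-sided statements for
    \<open>E\<close> at S apply.\<close>
  have less: "absval (fps_nth G i) * r ^ i < absval (fps_nth G i) * s ^ i"
    if "i \<in> dominant_indices G R" "0 < r" "r < s" for i r s
    using that dominant_indices_nth_neq_0[OF nz(3) R that(1)] pos
    by (intro mult_strict_left_mono power_strict_mono) auto
  define i where "i = Min (dominant_indices G R)"
  have i: "i \<in> dominant_indices G R"
    unfolding i_def using dom by (rule Min_in)
  have "\<forall>\<^sub>F r in at_left R. 0 < r \<and> r < R"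
    using R eventually_at_left_real[of 0 R] by simp
  then have "\<forall>\<^sub>F r in at_left R. absval (fps_nth G i) * r ^ i < S"
    unfolding S_def dominant_indices_eq_value[OF d i] by (rule eventually_mono) (use less[OF i] in auto)
  then have "filterlim (\<lambda>r. absval (fps_nth G i) * r ^ i) (at_left S) (at_left R)"
    using lim[OF i] by (simp add: filterlim_at) (auto elim: eventually_mono)
  then have "\<forall>\<^sub>F r in at_left R. strictly_dominant E (absval (fps_nth G i) * r ^ i) (Min (dominant_indices E S))"
    using eventually_strictly_dominant_left[OF ent(2) nz(2) S] by (rule eventually_compose_filterlim[rotated])
  moreover note eventually_strictly_dominant_left[OF ent(1) nz(1) R]
    eventually_strictly_dominant_left[OF ent(3) nz(3) R]
  ultimately have "\<forall>\<^sub>F r in at_left R. strictly_dominant F r (Min (dominant_indices F R)) \<and>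
      strictly_dominant G r i \<and> strictly_dominant E (absval (fps_nth G i) * r ^ i) (Min (dominant_indices E S))"
    unfolding i_def by eventually_elim blast
  then obtain a where "a < R" "\<And>r. a < r \<Longrightarrow> r < R \<Longrightarrow> strictly_dominant F r (Min (dominant_indices F R)) \<and>
      strictly_dominant G r i \<and> strictly_dominant E (absval (fps_nth G i) * r ^ i) (Min (dominant_indices E S))"
    unfolding eventually_at_left_field by blast
  then show "Min (dominant_indices F R) = Min (dominant_indices E S) * Min (dominant_indices G R)"
    unfolding i_def[symmetric] using R
    \<comment> \<open>The maximum with 0 keeps the interval among positive radii.\<close>
    by (intro dominant_index_composition[OF ent comp, of "max 0 a" R]) auto
  define j where "j = Max (dominant_indices G R)"
  have j: "j \<in> dominant_indices G R"
    unfolding j_def using dom by (rule Max_in)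
  have "\<forall>\<^sub>F r in at_right R. R < r"
    by (simp add: eventually_at_filter)
  then have "\<forall>\<^sub>F r in at_right R. S < absval (fps_nth G j) * r ^ j"
    unfolding S_def dominant_indices_eq_value[OF d j] by (rule eventually_mono) (use less[OF j] R in auto)
  then have "filterlim (\<lambda>r. absval (fps_nth G j) * r ^ j) (at_right S) (at_right R)"
    using lim[OF j] by (simp add: filterlim_at) (auto elim: eventually_mono)
  then have "\<forall>\<^sub>F r in at_right R. strictly_dominant E (absval (fps_nth G j) * r ^ j) (Max (dominant_indices E S))"
    using eventually_strictly_dominant_right[OF ent(2) nz(2) S] by (rule eventually_compose_filterlim[rotated])
  moreover note eventually_strictly_dominant_right[OF ent(1) nz(1) R]
    eventually_strictly_dominant_right[OF ent(3) nz(3) R]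
  ultimately have "\<forall>\<^sub>F r in at_right R. strictly_dominant F r (Max (dominant_indices F R)) \<and>
      strictly_dominant G r j \<and> strictly_dominant E (absval (fps_nth G j) * r ^ j) (Max (dominant_indices E S))"
    unfolding j_def by eventually_elim blast
  then obtain b where "R < b" "\<And>r. R < r \<Longrightarrow> r < b \<Longrightarrow> strictly_dominant F r (Max (dominant_indices F R)) \<and>
      strictly_dominant G r j \<and> strictly_dominant E (absval (fps_nth G j) * r ^ j) (Max (dominant_indices E S))"
    unfolding eventually_at_right_field by blast
  then show "Max (dominant_indices F R) = Max (dominant_indices E S) * Max (dominant_indices G R)"
    unfolding j_def[symmetric] using R
    by (intro dominant_index_composition[OF ent comp, of R b]) auto
qed

lemma transcendental_composition_slope_jump:
  assumes ent: "entire (F :: 'a fps)" "entire E" "entire G"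
    and E: "\<And>n. \<exists>j>n. fps_nth E j \<noteq> 0" and G: "\<And>n. \<exists>j>n. fps_nth G j \<noteq> 0"
    and comp: "\<And>x. entire_eval F x = entire_eval E (entire_eval G x)"
    and "F \<noteq> 0" and "R0 > 0"
  obtains R where "R \<ge> R0" "Min (dominant_indices F R) + 2 \<le> Max (dominant_indices F R)"
proof -
  have nz: "E \<noteq> 0" "G \<noteq> 0"
    using E G by auto
  obtain j where j: "j > 0" "fps_nth G j \<noteq> 0"
    using G by blast
  \<comment> \<open>An index above 1, so that the dominant indices of \<open>E\<close> at large
    radii are at least 2.\<close>
  obtain e where e: "e > 1" "fps_nth E e \<noteq> 0"
    using E by blast
  obtain S0 where S0: "\<And>S. S \<ge> S0 \<Longrightarrow> \<forall>i\<in>dominant_indices E S. i \<ge> e"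
    using eventually_dominant_indices_ge[OF e(2)] unfolding eventually_at_top_linorder by blast
  have "filterlim (\<lambda>R. absval (fps_nth G j) * R ^ j) at_top (at_top :: real filter)"
    using j by (intro filterlim_tendsto_pos_mult_at_top[OF tendsto_const] filterlim_pow_at_top filterlim_ident) auto
  then have "\<forall>\<^sub>F R in at_top. S0 \<le> absval (fps_nth G j) * R ^ j"
    by (simp add: filterlim_at_top)
  with eventually_dominant_indices_ge[OF j(2)]
  have "\<forall>\<^sub>F R in at_top. S0 \<le> absval (fps_nth G j) * R ^ j \<and> (\<forall>i\<in>dominant_indices G R. i \<ge> j)"
    by eventually_elim blast
  then obtain R1 where R1: "\<And>R. R \<ge> R1 \<Longrightarrow>
      S0 \<le> absval (fps_nth G j) * R ^ j \<and> (\<forall>i\<in>dominant_indices G R. i \<ge> j)"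
    unfolding eventually_at_top_linorder by blast
  have "max R0 R1 > 0"
    using \<open>R0 > 0\<close> by simp
  then obtain R where R: "R \<ge> max R0 R1" "Min (dominant_indices G R) < Max (dominant_indices G R)"
    using ex_critical_radius[OF ent(3) G] by metis
  have "R > 0"
    using R(1) \<open>R0 > 0\<close> by simp
  note domG = dominant_indices_finite_nonempty[OF ent(3) nz(2) \<open>R > 0\<close>]
  define d where "d = Min (dominant_indices G R)"
  define d' where "d' = Max (dominant_indices G R)"
  have d: "d \<in> dominant_indices G R"
    unfolding d_def using domG by (rule Min_in)
  have pos: "\<forall>i\<in>dominant_indices G R. i > 0"
    using R1[of R] R(1) j by force
  define S where "S = absval (fps_nth G d) * R ^ d"
  \<comment> \<open>The dominant term d of G is at least its term j, which is at least S0 at radii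
    from R1 on.\<close>
  have "S0 \<le> S"
    using R1[of R] R(1) dominant_indicesD[OF d, of j] by (simp add: S_def)
  have "S > 0"
    using dominant_indices_nth_neq_0[OF nz(2) \<open>R > 0\<close> d] \<open>R > 0\<close> by (simp add: S_def)
  note domE = dominant_indices_finite_nonempty[OF ent(2) nz(1) \<open>S > 0\<close>]
  define k where "k = Min (dominant_indices E S)"
  define k' where "k' = Max (dominant_indices E S)"
  have "k \<in> dominant_indices E S"
    unfolding k_def using domE by (rule Min_in)
  then have "2 \<le> k" "k \<le> k'"
    using S0[OF \<open>S0 \<le> S\<close>] e(1) Max_ge[OF domE(1)] by (force simp: k'_def)+
  \<comment> \<open>As d' >= d + 1 and k' >= k, the jump k' d' - k d is at least k, and k >=
    2.\<close>
  have "k * d + 2 \<le> k * (d + 1)"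
    using \<open>2 \<le> k\<close> by simp
  also have "\<dots> \<le> k' * d'"
    using \<open>k \<le> k'\<close> R(2) by (intro mult_le_mono) (auto simp: d_def d'_def)
  finally have "Min (dominant_indices F R) + 2 \<le> Max (dominant_indices F R)"
    using dominant_indices_composition[OF ent \<open>F \<noteq> 0\<close> nz comp \<open>R > 0\<close> d pos]
    by (simp add: k_def k'_def d_def d'_def S_def)
  moreover have "R0 \<le> R"
    using R(1) by simp
  ultimately show ?thesis
    using that by blast
qed

lemma transcendental_coeffs:
  assumes "\<not> rational_function (Fract E (1 :: 'a fps))"
  shows "\<exists>j>n. fps_nth E j \<noteq> 0"
proof (rule ccontr)
  assume "\<not> ?thesis"
  then have "E = fps_of_poly (Poly (map (fps_nth E) [0..<Suc n]))"
    by (auto simp: fps_eq_iff nth_default_def simp del: upt_Suc)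
  then show False
    using assms rational_function_of_polys[of 1] by (metis fps_of_poly_1 zero_neq_one)
qed

end

theorem theorem2p9:
  fixes p N n\<^sub>0 :: nat
    and f :: "'a :: nonarch_field fps"
  assumes "prime p"
    and "is_padic_complex_field p TYPE('a)"
    and "entire f"
    and "\<forall>n<N. fps_nth f n = 0"
    and "\<forall>n\<ge>N. fps_nth f n \<noteq> 0"
    and "n\<^sub>0 \<ge> N"
    and "strict_mono_on {n\<^sub>0..} (\<lambda>n. absval (fps_nth f n / fps_nth f (Suc n)))"
    and "\<not> bdd_above ((\<lambda>n. absval (fps_nth f n / fps_nth f (Suc n))) ` {n\<^sub>0..})"
  shows "pseudo_prime (Fract f 1)"
proof -
  interpret padic_complex_field p "TYPE('a)"
    by unfold_locales (fact assms)+
  have nz: "fps_nth f n \<noteq> 0" if "n \<ge> n\<^sub>0" for n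
    using assms(5,6) that by simp
  from nz[of n\<^sub>0] have "f \<noteq> 0"
    by auto
  have False
    if comp: "is_composition (Fract f 1) h g"
      and hg: "h \<in> meromorphic_functions" "g \<in> meromorphic_functions"
      and nr: "\<not> rational_function h" "\<not> rational_function g" for h g
  proof -
    obtain E G where EG: "entire E" "entire G" "h = Fract E 1" "g = Fract G 1"
      using composition_entire_imp_entire[OF \<open>entire f\<close> comp hg nr] .
    have eval: "entire_eval f x = entire_eval E (entire_eval G x)" for x
    proof -
      \<comment> \<open>\<open>G\<close> has a value at every point, and so has \<open>E\<close> at
        every value of \<open>G\<close>, so the composition hypothesis applies at every x.\<close>
      have "has_value_at (Fract f 1) x (entire_eval E (entire_eval G x))"
        using comp EG has_value_at_entire unfolding is_composition_def by blast
      then show ?thesis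
        using has_value_at_entire[OF \<open>entire f\<close>] has_value_at_unique by blast
    qed
    \<comment> \<open>From R0 on only indices at least \<open>n\<^sub>0\<close> are dominant, and
      there the ratios are known to increase.\<close>
    obtain R0 where R0: "\<And>R. R \<ge> R0 \<Longrightarrow> \<forall>i\<in>dominant_indices f R. i \<ge> n\<^sub>0"
      using eventually_dominant_indices_ge[OF nz[of n\<^sub>0]] unfolding eventually_at_top_linorder by blast
    have "\<exists>j>n. fps_nth E j \<noteq> 0" "\<exists>j>n. fps_nth G j \<noteq> 0" for n
      using nr EG(3,4) by (auto intro!: transcendental_coeffs)
    then obtain R where R: "R \<ge> max R0 1" "Min (dominant_indices f R) + 2 \<le> Max (dominant_indices f R)"
      using transcendental_composition_slope_jump[OF \<open>entire f\<close> EG(1,2) _ _ eval \<open>f \<noteq> 0\<close>, of "max R0 1"]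
      by (metis less_max_iff_disj zero_less_one)
    then have "R > 0" by simp
    note dom = dominant_indices_finite_nonempty[OF \<open>entire f\<close> \<open>f \<noteq> 0\<close> this]
    have "Max (dominant_indices f R) \<le> Suc (Min (dominant_indices f R))"
      using R(1) \<open>R > 0\<close> R0[of R] Min_in[OF dom] Max_in[OF dom]
      by (intro dominant_indices_at_most_consecutive[OF nz assms(7)]) auto
    with R(2) show False by simp
  qed
  moreover have "Fract f 1 \<in> meromorphic_functions"
    using \<open>entire f\<close> by (intro meromorphicI) auto
  ultimately show ?thesis
    unfolding pseudo_prime_def by blast
qed

end
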